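(* Let $k,l\ge 1$ be integers. Let $\Delta: R_{k,l}\to R_{k,l}\otimes_{R_{k+l}}R_{k,l}$ be the $R_{k,l}$-linear map (linear with respect to the left $R_{k,l}$-module structures) determined by $$\Delta(1)=\sum_{\substack{\alpha=(\alpha_1,\ldots,\alpha_k)\\ l\ge\alpha_1\ge\cdots\ge\alpha_k\ge 0}}(-1)^{\sum_{i=1}^k\alpha_i}\,\pi_{\alpha}\otimes\pi'_{\overline{\alpha^*}}.$$ Then $\Delta$ is a homomorphism of $R_{k,l}$-bimodules. Moreover, up to multiplication by a nonzero scalar, $\Delta$ is the only (nonzero) bimodule map $R_{k,l}\to R_{k,l}\otimes_{R_{k+l}}R_{k,l}$ of degree $2kl$, and there are no nonzero (homogeneous) bimodule maps $R_{k,l}\to R_{k,l}\otimes_{R_{k+l}}R_{k,l}$ of degree strictly less than $2kl$.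
   Context: Let $\mathbb{C}[z_1,\ldots,z_{k+l}]$ be graded by $\deg z_i=2$. $R_{k+l}\subset\mathbb{C}[z_1,\ldots,z_{k+l}]$ is the subring of polynomials invariant under $S_{k+l}$, and $R_{k,l}$ is the subring of polynomials invariant under $S_k\times S_l$ ($S_k$ permuting $z_1,\ldots,z_k$ and $S_l$ permuting $z_{k+1},\ldots,z_{k+l}$); thus $R_{k+l}\subset R_{k,l}$. Both $R_{k,l}$ and $R_{k,l}\otimes_{R_{k+l}}R_{k,l}$ are graded $R_{k,l}$-bimodules, with left and right multiplication (on the left, respectively right, tensor factor in the second case). A map has degree $d$ if it is homogeneous and raises degree by $d$; scalars are complex numbers. For a partition $\alpha=(\alpha_1,\ldots,\alpha_k)$, $\pi_\alpha\in R_{k,l}$ denotes the Schur polynomial of $\alpha$ in the variables $z_1,\ldots,z_k$, that is, $\pi_\alpha=\det(z_i^{\alpha_j+k-j})_{1\le i,j\le k}/\prod_{1\le i<j\le k}(z_i-z_j)$. For a partition $\beta=(\beta_1,\ldots,\beta_l)$, $\pi'_\beta\in R_{k,l}$ denotes the Schur polynomial of $\beta$ in the $l$ variables $z_{k+1},\ldots,z_{k+l}$. For a partition $\alpha=(\alpha_1,\ldots,\alpha_k)$ with $l\ge\alpha_1\ge\cdots\ge\alpha_k\ge0$, the complementary partition is $\alpha^*=(l-\alpha_k,\ldots,l-\alpha_1)$. For a partition $\gamma$, $\overline{\gamma}$ denotes the conjugate partition, $\overline{\gamma}_j=\#\{i\mid\gamma_i\ge j\}$; so $\overline{\alpha^*}=(\overline{\alpha^*}_1,\ldots,\overline{\alpha^*}_l)$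 has $l$ parts, each at most $k$. *)

theory Defs
  imports
    "HOL-Library.Poly_Mapping"
    "HOL-Algebra.Module"
    "HOL-Algebra.Generated_Groups"
    "HOL-Algebra.Free_Abelian_Groups"
    "HOL-Combinatorics.Permutations"
    "Jordan_Normal_Form.Determinant"
begin

text \<open>Complex polynomials in the variables \<open>z\<^sub>i\<close>, \<open>i :: nat\<close>, represented by their finitely supported
  coefficient functions on monomials; a monomial is a finitely supported exponent function.\<close>

type_synonym mpoly = "(nat \<Rightarrow>\<^sub>0 nat) \<Rightarrow>\<^sub>0 complex"

definition Var :: "nat \<Rightarrow> mpoly" where
  "Var i = Poly_Mapping.single (Poly_Mapping.single i 1) 1"

definition Const :: "complex \<Rightarrow> mpoly" where
  "Const c = Poly_Mapping.single 0 c"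

definition polys_in :: "nat set \<Rightarrow> mpoly set" where
  "polys_in V = {p. \<forall>m \<in> Poly_Mapping.keys p. Poly_Mapping.keys m \<subseteq> V}"

text \<open>For a permutation \<open>\<sigma>\<close>, the following is the substitution \<open>z\<^sub>i \<mapsto> z\<^sub>\<sigma>\<^sub>(\<^sub>i\<^sub>)\<close>: the coefficient of the
  result at the monomial \<open>m\<close> is the coefficient of \<open>p\<close> at \<open>m \<circ> \<sigma>\<close>.\<close>

definition perm_act :: "(nat \<Rightarrow> nat) \<Rightarrow> mpoly \<Rightarrow> mpoly" where
  "perm_act \<sigma> p = Poly_Mapping.map_key (Poly_Mapping.map_key \<sigma>) p"

lemma perm_act_Var:
  assumes "bij \<sigma>"
  shows "perm_act \<sigma> (Var i) = Var (\<sigma> i)"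
proof -
  have inj: "inj \<sigma>" using assms by (rule bij_is_inj)
  have inj': "inj (Poly_Mapping.map_key \<sigma> :: (nat \<Rightarrow>\<^sub>0 nat) \<Rightarrow> (nat \<Rightarrow>\<^sub>0 nat))"
  proof (rule injI, rule poly_mapping_eqI)
    fix m m' :: "nat \<Rightarrow>\<^sub>0 nat" and j
    assume eq: "Poly_Mapping.map_key \<sigma> m = Poly_Mapping.map_key \<sigma> m'"
    obtain i where "j = \<sigma> i" using assms by (metis bij_pointE)
    then show "Poly_Mapping.lookup m j = Poly_Mapping.lookup m' j"
      using arg_cong[OF eq, of "\<lambda>q. Poly_Mapping.lookup q i"] inj by (simp add: map_key.rep_eq)
  qed
  have "Poly_Mapping.single i 1 = Poly_Mapping.map_key \<sigma> (Poly_Mapping.single (\<sigma> i) (1::nat))"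
    using inj by simp
  then show ?thesis
    unfolding perm_act_def Var_def using map_key_single[OF inj'] by simp
qed

definition R_sym :: "nat \<Rightarrow> mpoly set" where
  "R_sym n = {p \<in> polys_in {1..n}. \<forall>\<sigma>. \<sigma> permutes {1..n} \<longrightarrow> perm_act \<sigma> p = p}"

definition R_pair :: "nat \<Rightarrow> nat \<Rightarrow> mpoly set" where
  "R_pair k l = {p \<in> polys_in {1..k + l}.
     \<forall>\<sigma> \<tau>. \<sigma> permutes {1..k} \<longrightarrow> \<tau> permutes {k + 1..k + l} \<longrightarrow> perm_act (\<sigma> \<circ> \<tau>) p = p}"

text \<open>Every variable has degree 2; the zero polynomial is homogeneous of every degree.\<close>

definition homogeneous :: "int \<Rightarrow> mpoly \<Rightarrow> bool" where
  "homogeneous d p \<longleftrightarrow> (\<forall>m \<in> Poly_Mapping.keys p.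
     2 * int (\<Sum>i \<in> Poly_Mapping.keys m. Poly_Mapping.lookup m i) = d)"

text \<open>As for the record \<open>module\<close>, the ring operations \<open>mult\<close> and \<open>one\<close> are irrelevant;
  \<open>smult\<close> is the left action, \<open>rsmult\<close> the right one, and \<open>grade M n\<close> is the component of degree \<open>n\<close>.\<close>

record ('r, 'm) graded_bimodule = "('r, 'm) module" +
  rsmult :: "'m \<Rightarrow> 'r \<Rightarrow> 'm"
  grade :: "int \<Rightarrow> 'm set"

definition bimodule_hom ::
  "'r set \<Rightarrow> ('r, 'm) graded_bimodule \<Rightarrow> ('r, 'n) graded_bimodule \<Rightarrow> ('m \<Rightarrow> 'n) set" where
  "bimodule_hom R M N = {f \<in> carrier M \<rightarrow> carrier N.
     (\<forall>x \<in> carrier M. \<forall>y \<in> carrier M. f (x \<oplus>\<^bsub>M\<^esub> y) = f x \<oplus>\<^bsub>N\<^esub> f y) \<and>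
     (\<forall>r \<in> R. \<forall>x \<in> carrier M. f (r \<odot>\<^bsub>M\<^esub> x) = r \<odot>\<^bsub>N\<^esub> f x) \<and>
     (\<forall>r \<in> R. \<forall>x \<in> carrier M. f (rsmult M x r) = rsmult N (f x) r)}"

definition has_degree ::
  "('r, 'm) graded_bimodule \<Rightarrow> ('r, 'n) graded_bimodule \<Rightarrow> ('m \<Rightarrow> 'n) \<Rightarrow> int \<Rightarrow> bool" where
  "has_degree M N f d \<longleftrightarrow> (\<forall>n. \<forall>x \<in> grade M n. f x \<in> grade N (n + d))"

definition nonzero_map ::
  "('r, 'm) graded_bimodule \<Rightarrow> ('r, 'n) graded_bimodule \<Rightarrow> ('m \<Rightarrow> 'n) \<Rightarrow> bool" where
  "nonzero_map M N f \<longleftrightarrow> (\<exists>x \<in> carrier M. f x \<noteq> \<zero>\<^bsub>N\<^esub>)"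

definition regular_bimodule :: "mpoly set \<Rightarrow> (mpoly, mpoly) graded_bimodule" where
  "regular_bimodule R =
    \<lparr>carrier = R, monoid.mult = (*), one = 1, zero = 0, add = (+), module.smult = (*), rsmult = (*),
     grade = (\<lambda>d. {p \<in> R. homogeneous d p})\<rparr>"

text \<open>The tensor product over \<open>S\<close> is the free abelian group on \<open>carrier M \<times> carrier N\<close> modulo
  the subgroup generated by the relations of biadditivity and \<open>S\<close>-balancedness.
  Its elements are cosets.\<close>

definition tensor_free ::
  "('r, 'm) graded_bimodule \<Rightarrow> ('r, 'n) graded_bimodule \<Rightarrow> ('m \<times> 'n \<Rightarrow>\<^sub>0 int) monoid" where
  "tensor_free M N = free_Abelian_group (carrier M \<times> carrier N)"

definition tensor_relators ::
  "'r set \<Rightarrow> ('r, 'm) graded_bimodule \<Rightarrow> ('r, 'n) graded_bimodule \<Rightarrow> ('m \<times> 'n \<Rightarrow>\<^sub>0 int) set" where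
  "tensor_relators S M N =
     {frag_of (x \<oplus>\<^bsub>M\<^esub> x', y) - frag_of (x, y) - frag_of (x', y) | x x' y.
        x \<in> carrier M \<and> x' \<in> carrier M \<and> y \<in> carrier N} \<union>
     {frag_of (x, y \<oplus>\<^bsub>N\<^esub> y') - frag_of (x, y) - frag_of (x, y') | x y y'.
        x \<in> carrier M \<and> y \<in> carrier N \<and> y' \<in> carrier N} \<union>
     {frag_of (rsmult M x s, y) - frag_of (x, s \<odot>\<^bsub>N\<^esub> y) | x s y.
        x \<in> carrier M \<and> s \<in> S \<and> y \<in> carrier N}"

definition tensor_kernel ::
  "'r set \<Rightarrow> ('r, 'm) graded_bimodule \<Rightarrow> ('r, 'n) graded_bimodule \<Rightarrow> ('m \<times> 'n \<Rightarrow>\<^sub>0 int) set" where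
  "tensor_kernel S M N = generate (tensor_free M N) (tensor_relators S M N)"

definition tensor_class ::
  "'r set \<Rightarrow> ('r, 'm) graded_bimodule \<Rightarrow> ('r, 'n) graded_bimodule \<Rightarrow>
    ('m \<times> 'n \<Rightarrow>\<^sub>0 int) \<Rightarrow> ('m \<times> 'n \<Rightarrow>\<^sub>0 int) set" where
  "tensor_class S M N c = tensor_kernel S M N #>\<^bsub>tensor_free M N\<^esub> c"

definition pure_tensor ::
  "'r set \<Rightarrow> ('r, 'm) graded_bimodule \<Rightarrow> ('r, 'n) graded_bimodule \<Rightarrow>
    'm \<Rightarrow> 'n \<Rightarrow> ('m \<times> 'n \<Rightarrow>\<^sub>0 int) set" where
  "pure_tensor S M N x y = tensor_class S M N (frag_of (x, y))"

text \<open>The actions are \<open>r(x \<otimes> y) = rx \<otimes> y\<close> and \<open>(x \<otimes> y)r = x \<otimes> yr\<close>, extended additively to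
  representatives; the unions below are over representatives of one coset and consist of a
  single coset.  The component of degree \<open>d\<close> is spanned by the \<open>x \<otimes> y\<close> with \<open>x\<close> and \<open>y\<close>
  homogeneous of degrees adding up to \<open>d\<close>.\<close>

definition tensor_product ::
  "'r set \<Rightarrow> ('r, 'm) graded_bimodule \<Rightarrow> ('r, 'n) graded_bimodule \<Rightarrow>
    ('r, ('m \<times> 'n \<Rightarrow>\<^sub>0 int) set) graded_bimodule" where
  "tensor_product S M N = (let Q = tensor_free M N Mod tensor_kernel S M N in
    \<lparr>carrier = carrier Q, monoid.mult = undefined, one = undefined, zero = \<one>\<^bsub>Q\<^esub>, add = monoid.mult Q,
     module.smult = (\<lambda>r X. \<Union>c \<in> X. tensor_class S M N (frag_extend (\<lambda>(x, y). frag_of (r \<odot>\<^bsub>M\<^esub> x, y)) c)),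
     rsmult = (\<lambda>X r. \<Union>c \<in> X. tensor_class S M N (frag_extend (\<lambda>(x, y). frag_of (x, rsmult N y r)) c)),
     grade = (\<lambda>d. generate Q
       {pure_tensor S M N x y | x y. \<exists>i j. x \<in> grade M i \<and> y \<in> grade N j \<and> i + j = d})\<rparr>)"

text \<open>Partitions are weakly decreasing lists, with trailing zeros allowed; the part \<open>\<alpha>\<^sub>i\<close> is \<open>\<alpha> ! (i - 1)\<close>.\<close>

definition box_partitions :: "nat \<Rightarrow> nat \<Rightarrow> nat list set" where
  "box_partitions k l = {\<alpha>. length \<alpha> = k \<and> sorted_wrt (\<ge>) \<alpha> \<and> (\<forall>a \<in> set \<alpha>. a \<le> l)}"

definition complementary :: "nat \<Rightarrow> nat list \<Rightarrow> nat list" where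
  "complementary l \<alpha> = rev (map (\<lambda>a. l - a) \<alpha>)"

text \<open>The first \<open>n\<close> parts of the conjugate partition.\<close>

definition conjugate :: "nat \<Rightarrow> nat list \<Rightarrow> nat list" where
  "conjugate n \<gamma> = map (\<lambda>j. card {i. i < length \<gamma> \<and> \<gamma> ! i \<ge> j}) [1..<Suc n]"

text \<open>The Schur polynomial of \<open>\<alpha>\<close> in the variables \<open>z\<^sub>s\<^sub>+\<^sub>1, \<dots>, z\<^sub>s\<^sub>+\<^sub>n\<close> with \<open>n = length \<alpha>\<close>, as the
  quotient of an alternant by the Vandermonde product.  The quotient is unique because
  \<open>mpoly\<close> is an integral domain.\<close>

definition alternant :: "nat \<Rightarrow> nat list \<Rightarrow> mpoly" where
  "alternant s \<alpha> = (let n = length \<alpha> in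
     det (mat n n (\<lambda>(i, j). Var (s + Suc i) ^ (\<alpha> ! j + n - Suc j))))"

definition vandermonde :: "nat \<Rightarrow> nat \<Rightarrow> mpoly" where
  "vandermonde s n =
     (\<Prod>(i, j) \<in> {(i, j). 1 \<le> i \<and> i < j \<and> j \<le> n}. Var (s + i) - Var (s + j))"

definition schur :: "nat \<Rightarrow> nat list \<Rightarrow> mpoly" where
  "schur s \<alpha> = (THE q. q * vandermonde s (length \<alpha>) = alternant s \<alpha>)"

abbreviation Rkl :: "nat \<Rightarrow> nat \<Rightarrow> (mpoly, mpoly) graded_bimodule" where
  "Rkl k l \<equiv> regular_bimodule (R_pair k l)"

abbreviation Rkl_tensor ::
  "nat \<Rightarrow> nat \<Rightarrow> (mpoly, (mpoly \<times> mpoly \<Rightarrow>\<^sub>0 int) set) graded_bimodule" where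
  "Rkl_tensor k l \<equiv> tensor_product (R_sym (k + l)) (Rkl k l) (Rkl k l)"

definition Delta_one :: "nat \<Rightarrow> nat \<Rightarrow> (mpoly \<times> mpoly \<Rightarrow>\<^sub>0 int) set" where
  "Delta_one k l = (\<Oplus>\<^bsub>Rkl_tensor k l\<^esub> \<alpha> \<in> box_partitions k l.
     (-1) ^ sum_list \<alpha> \<odot>\<^bsub>Rkl_tensor k l\<^esub>
       pure_tensor (R_sym (k + l)) (Rkl k l) (Rkl k l)
         (schur 0 \<alpha>) (schur k (conjugate l (complementary l \<alpha>))))"

definition Delta :: "nat \<Rightarrow> nat \<Rightarrow> mpoly \<Rightarrow> (mpoly \<times> mpoly \<Rightarrow>\<^sub>0 int) set" where
  "Delta k l p = p \<odot>\<^bsub>Rkl_tensor k l\<^esub> Delta_one k l"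

end

theory Submission
  imports Defs
begin

text \<open>
  Write \<open>n = k + l\<close>, \<open>R = R_pair k l\<close>, \<open>S = R_sym n\<close> and \<open>T\<close> for the tensor square of \<open>R\<close> over \<open>S\<close>.
  A bimodule map from \<open>R\<close> to \<open>T\<close> is the same as an element \<open>t\<close> of \<open>T\<close> (the image of \<open>1\<close>) on which the
  left and the right action of \<open>R\<close> agree. Every permutation \<open>w\<close> of the \<open>n\<close> variables gives an evaluation
  \<open>conj_eval w\<close> from \<open>T\<close> to polynomials, \<open>x \<otimes> y \<mapsto> x \<cdot> w(y)\<close>, and the proof reads everything off from
  these evaluations.

  They are jointly injective (\<open>conj_eval_injective\<close>). The reason is a pair of dual bases: the trace
  \<open>q \<mapsto> \<Sum>\<^sub>w w(q / \<Prod>(z\<^sub>i - z\<^sub>j))\<close>, with \<open>i \<le> k < j\<close> and \<open>w\<close> running over all permutations, maps \<open>R\<close> to \<open>S\<close>,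
  and up to signs and a common scalar the Schur polynomials \<open>\<pi>\<^sub>\<alpha>\<close> and \<open>\<pi>'\<^sub>\<beta>\<close>, with \<open>\<beta>\<close> conjugate to the
  complement of \<open>\<alpha>\<close>, are dual for it (\<open>trace_dual_bases\<close>). So every tensor can be written as a sum of
  terms \<open>c\<^sub>\<alpha> \<otimes> \<pi>'\<^sub>\<beta>\<close> in which \<open>c\<^sub>\<alpha>\<close> is a combination of its evaluations.

  Duality and the evaluations of \<open>\<Delta>(1)\<close> both come from the dual Cauchy identity (\<open>dual_cauchy\<close>):
  the signed sum of the products \<open>\<pi>\<^sub>\<alpha> \<pi>'\<^sub>\<beta>\<close> is \<open>\<Prod>(z\<^sub>i - z\<^sub>j)\<close> up to sign. It is the Laplace expansion of the
  Vandermonde determinant of all the variables along the rows that belong to the first \<open>k\<close> of them.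
  When \<open>w\<close> acts on one of the two alphabets only, this product acquires a zero factor unless \<open>w\<close> preserves
  \<open>{1..k}\<close>. Hence \<open>\<Delta>(1)\<close> evaluates to \<open>0\<close> for every \<open>w\<close> that mixes the two blocks; the other \<open>w\<close> act
  trivially on \<open>R\<close>, so in all evaluations the two actions of \<open>R\<close> on \<open>\<Delta>(1)\<close> agree, and \<open>\<Delta>\<close> is a bimodule map.

  Conversely let the two actions agree on \<open>t\<close>. Then \<open>(r - w(r)) \<cdot> conj_eval w t = 0\<close> for all \<open>r\<close>, and
  \<open>r = z\<^sub>1 + \<dots> + z\<^sub>k\<close> shows that the evaluation at a mixing \<open>w\<close> vanishes. If \<open>w\<close> exchanges \<open>i \<le> k\<close> and \<open>j > k\<close>,
  the evaluations at \<open>w\<close> and at the identity coincide once \<open>z\<^sub>i\<close> and \<open>z\<^sub>j\<close> are equated, so \<open>z\<^sub>i - z\<^sub>j\<close> divides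
  \<open>conj_eval id t\<close>. Therefore \<open>\<Prod>(z\<^sub>i - z\<^sub>j)\<close>, of degree \<open>2kl\<close>, divides it (\<open>central_element_divisible\<close>): in
  lower degree \<open>t\<close> is zero, and in degree \<open>2kl\<close> it has the same evaluations as a scalar multiple of \<open>\<Delta>(1)\<close>.
\<close>


section \<open>Induction on polynomials\<close>

lemma sum_monomials:
  "p = (\<Sum>m\<in>Poly_Mapping.keys p. Poly_Mapping.single m (Poly_Mapping.lookup p m))"
  by (rule poly_mapping_eqI) (auto simp: lookup_sum lookup_single when_def in_keys_iff)

lemma poly_mapping_add_induct [case_names single add]:
  fixes p :: "'a \<Rightarrow>\<^sub>0 'b::comm_monoid_add"
  assumes single: "\<And>m c. P (Poly_Mapping.single m c)"
    and add: "\<And>p q. P p \<Longrightarrow> P q \<Longrightarrow> P (p + q)"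
  shows "P p"
proof -
  have "P (\<Sum>m\<in>A. Poly_Mapping.single m (Poly_Mapping.lookup p m))" if "finite A" for A
    using that by (induction A) (use assms(1)[of undefined 0] in \<open>auto intro: assms\<close>)
  then show ?thesis using sum_monomials[of p] by (metis finite_keys)
qed

lemma single_single_eq_power:
  "Poly_Mapping.single (Poly_Mapping.single i a) (1::complex) = Var i ^ a"
proof (induction a)
  case (Suc a)
  have "Poly_Mapping.single (Poly_Mapping.single i (Suc a)) (1::complex)
      = Var i * Poly_Mapping.single (Poly_Mapping.single i a) 1"
    by (simp add: Var_def mult_single flip: single_add)
  then show ?case by (simp add: Suc)
qed simp

lemma single_monomial_eq_prod:
  "Poly_Mapping.single m c
     = Const c * (\<Prod>i\<in>Poly_Mapping.keys m. Var i ^ Poly_Mapping.lookup m i)"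
proof -
  have "Poly_Mapping.single (\<Sum>i\<in>A. Poly_Mapping.single i (Poly_Mapping.lookup m i)) (1::complex)
      = (\<Prod>i\<in>A. Var i ^ Poly_Mapping.lookup m i)" if "finite A" for A
    using that
  proof (induction A)
    case (insert i A)
    have "Poly_Mapping.single (\<Sum>i\<in>insert i A. Poly_Mapping.single i (Poly_Mapping.lookup m i)) (1::complex)
      = Poly_Mapping.single (Poly_Mapping.single i (Poly_Mapping.lookup m i)) 1
        * Poly_Mapping.single (\<Sum>i\<in>A. Poly_Mapping.single i (Poly_Mapping.lookup m i)) 1"
      using insert.hyps by (simp add: mult_single)
    then show ?case using insert by (simp add: single_single_eq_power)
  qed simp
  from this[OF finite_keys[of m]] have "Poly_Mapping.single m (1::complex)
      = (\<Prod>i\<in>Poly_Mapping.keys m. Var i ^ Poly_Mapping.lookup m i)"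
    by (simp flip: sum_monomials)
  then show ?thesis
    by (simp add: Const_def mult_single flip: \<open>Poly_Mapping.single m 1 = _\<close>)
qed

lemma Const_0 [simp]: "Const 0 = 0" and Const_1 [simp]: "Const 1 = 1"
  by (simp_all add: Const_def)

lemma Const_add: "Const (a + b) = Const a + Const b"
  by (simp add: Const_def single_add)

lemma Const_mult: "Const (a * b) = Const a * Const b"
  by (simp add: Const_def mult_single)

lemma Const_uminus: "Const (- a) = - Const a"
  by (simp add: Const_def single_uminus)

lemma Var_eq_iff [simp]: "Var i = Var j \<longleftrightarrow> i = j"
  by (metis Var_def keys_single singleton_inject zero_neq_one)

lemma mpoly_ring_induct [case_names Const Var add mult]:
  assumes "\<And>c. P (Const c)" "\<And>i. P (Var i)"
    and "\<And>p q. P p \<Longrightarrow> P q \<Longrightarrow> P (p + q)" "\<And>p q. P p \<Longrightarrow> P q \<Longrightarrow> P (p * q)"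
  shows "P p"
proof (induction p rule: poly_mapping_add_induct)
  case (single m c)
  have one: "P 1" using assms(1)[of 1] by simp
  have pow: "P (Var i ^ a)" for i a by (induction a) (auto intro: one assms)
  have "P (\<Prod>i\<in>A. Var i ^ Poly_Mapping.lookup m i)" if "finite A" for A
    using that by induction (auto intro: one pow assms)
  from assms(4)[OF assms(1) this[OF finite_keys]] show ?case
    by (simp only: single_monomial_eq_prod)
qed (rule assms)


section \<open>Renaming variables\<close>

definition rename_mon :: "(nat \<Rightarrow> nat) \<Rightarrow> (nat \<Rightarrow>\<^sub>0 nat) \<Rightarrow> (nat \<Rightarrow>\<^sub>0 nat)" where
  "rename_mon f m = (\<Sum>i\<in>Poly_Mapping.keys m. Poly_Mapping.single (f i) (Poly_Mapping.lookup m i))"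

text \<open>For a bijection this is \<open>perm_act\<close>. The maps that are not injective are the specialisations that
  detect divisibility by a difference of variables.\<close>
definition rename :: "(nat \<Rightarrow> nat) \<Rightarrow> mpoly \<Rightarrow> mpoly" where
  "rename f p = (\<Sum>m\<in>Poly_Mapping.keys p. Poly_Mapping.single (rename_mon f m) (Poly_Mapping.lookup p m))"

lemma rename_mon_0 [simp]: "rename_mon f 0 = 0"
  by (simp add: rename_mon_def)

lemma rename_mon_single [simp]: "rename_mon f (Poly_Mapping.single i a) = Poly_Mapping.single (f i) a"
  by (simp add: rename_mon_def)

lemma rename_mon_add: "rename_mon f (m + m') = rename_mon f m + rename_mon f m'"
  unfolding rename_mon_def by (rule setsum_keys_plus_distrib) (auto simp: single_add)

lemma rename_0 [simp]: "rename f 0 = 0"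
  by (simp add: rename_def)

lemma rename_add: "rename f (p + q) = rename f p + rename f q"
  unfolding rename_def by (rule setsum_keys_plus_distrib) (auto simp: single_add)

lemma rename_single: "rename f (Poly_Mapping.single m c) = Poly_Mapping.single (rename_mon f m) c"
  by (simp add: rename_def)

lemma rename_Var [simp]: "rename f (Var i) = Var (f i)"
  by (simp add: Var_def rename_single)

lemma rename_Const [simp]: "rename f (Const c) = Const c"
  by (simp add: Const_def rename_single)

lemma rename_1 [simp]: "rename f 1 = 1"
  using rename_Const[of f 1] by simp

lemma rename_mult: "rename f (p * q) = rename f p * rename f q"
proof (induction p rule: poly_mapping_add_induct)
  case (single m c)
  show ?case
    by (induction q rule: poly_mapping_add_induct)
       (simp_all add: mult_single rename_single rename_mon_add rename_add distrib_left)
qed (simp add: rename_add distrib_right)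

lemma rename_uminus: "rename f (- p) = - rename f p"
  using rename_add[of f p "- p"] by (simp add: eq_neg_iff_add_eq_0 add.commute)

lemma rename_diff: "rename f (p - q) = rename f p - rename f q"
  using rename_add[of f p "- q"] by (simp add: rename_uminus)

lemma rename_sum: "rename f (\<Sum>x\<in>A. g x) = (\<Sum>x\<in>A. rename f (g x))"
  by (induction A rule: infinite_finite_induct) (auto simp: rename_add)

lemma rename_prod: "rename f (\<Prod>x\<in>A. g x) = (\<Prod>x\<in>A. rename f (g x))"
  by (induction A rule: infinite_finite_induct) (auto simp: rename_mult)

lemma rename_power: "rename f (p ^ a) = rename f p ^ a"
  by (induction a) (auto simp: rename_mult)

lemma rename_of_int: "rename f (of_int c) = of_int c"
proof -
  have nat: "rename f (of_nat c) = of_nat c" for c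
    by (induction c) (auto simp: rename_add)
  show ?thesis by (cases c) (simp_all add: nat rename_uminus rename_diff)
qed

lemma rename_rename: "rename f (rename g p) = rename (f \<circ> g) p"
  by (induction p rule: mpoly_ring_induct) (auto simp: rename_add rename_mult)

lemma rename_id: "rename id p = p"
  by (induction p rule: mpoly_ring_induct) (auto simp: rename_add rename_mult)

lemma lookup_rename_mon:
  assumes "inj \<sigma>"
  shows "Poly_Mapping.lookup (rename_mon \<sigma> m) (\<sigma> i) = Poly_Mapping.lookup m i"
  using assms by (auto simp: rename_mon_def lookup_sum lookup_single when_def inj_eq in_keys_iff)

lemma perm_act_eq_rename:
  assumes "bij \<sigma>"
  shows "perm_act \<sigma> p = rename \<sigma> p"
proof -
  have inj: "inj \<sigma>" using assms by (rule bij_is_inj)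
  have inj': "inj (Poly_Mapping.map_key \<sigma> :: (nat \<Rightarrow>\<^sub>0 nat) \<Rightarrow> (nat \<Rightarrow>\<^sub>0 nat))"
  proof (rule injI, rule poly_mapping_eqI)
    fix m m' :: "nat \<Rightarrow>\<^sub>0 nat" and j
    assume eq: "Poly_Mapping.map_key \<sigma> m = Poly_Mapping.map_key \<sigma> m'"
    obtain i where "j = \<sigma> i" using assms by (metis bij_pointE)
    then show "Poly_Mapping.lookup m j = Poly_Mapping.lookup m' j"
      using arg_cong[OF eq, of "\<lambda>q. Poly_Mapping.lookup q i"] inj by (simp add: map_key.rep_eq)
  qed
  have m: "m = Poly_Mapping.map_key \<sigma> (rename_mon \<sigma> m)" for m
    by (rule poly_mapping_eqI) (simp add: inj map_key.rep_eq lookup_rename_mon)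
  show ?thesis
  proof (induction p rule: poly_mapping_add_induct)
    case (single m c)
    show ?case
      unfolding perm_act_def rename_single by (subst m) (rule map_key_single[OF inj'])
  next
    case (add p q)
    then show ?case unfolding perm_act_def rename_add using inj' by (simp add: map_key_plus)
  qed
qed


section \<open>Homogeneity\<close>

text \<open>The weight \<open>2\<close> on all variables gives the grading. The weight that is \<open>0\<close> on \<open>V\<close> and \<open>1\<close> elsewhere
  turns membership in \<open>polys_in V\<close> into homogeneity of weight \<open>0\<close>, so that one argument serves both.\<close>
definition mon_weight :: "(nat \<Rightarrow> nat) \<Rightarrow> (nat \<Rightarrow>\<^sub>0 nat) \<Rightarrow> nat" where
  "mon_weight \<mu> m = (\<Sum>i\<in>Poly_Mapping.keys m. \<mu> i * Poly_Mapping.lookup m i)"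

definition homog :: "(nat \<Rightarrow> nat) \<Rightarrow> int \<Rightarrow> mpoly \<Rightarrow> bool" where
  "homog \<mu> d p \<longleftrightarrow> (\<forall>m\<in>Poly_Mapping.keys p. int (mon_weight \<mu> m) = d)"

lemma mon_weight_add: "mon_weight \<mu> (m + m') = mon_weight \<mu> m + mon_weight \<mu> m'"
  unfolding mon_weight_def by (rule setsum_keys_plus_distrib) (auto simp: algebra_simps)

lemma homogeneous_iff_homog: "homogeneous d p \<longleftrightarrow> homog (\<lambda>_. 2) d p"
  by (auto simp: homogeneous_def homog_def mon_weight_def sum_distrib_left)

lemma polys_in_iff_homog: "p \<in> polys_in V \<longleftrightarrow> homog (\<lambda>i. if i \<in> V then 0 else 1) 0 p"
proof -
  have "mon_weight (\<lambda>i. if i \<in> V then 0 else 1) m = 0 \<longleftrightarrow> Poly_Mapping.keys m \<subseteq> V" for m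
    by (auto simp: mon_weight_def in_keys_iff)
  then show ?thesis by (auto simp: polys_in_def homog_def)
qed

lemma homog_0 [simp]: "homog \<mu> d 0"
  by (simp add: homog_def)

lemma homog_Const [simp]: "homog \<mu> 0 (Const c)"
  by (simp add: homog_def Const_def mon_weight_def)

lemma homog_1 [simp]: "homog \<mu> 0 1"
  using homog_Const[of \<mu> 1] by simp

lemma homog_Var: "homog \<mu> (int (\<mu> i)) (Var i)"
  by (simp add: homog_def Var_def mon_weight_def)

lemma homog_add: "homog \<mu> d p \<Longrightarrow> homog \<mu> d q \<Longrightarrow> homog \<mu> d (p + q)"
  unfolding homog_def using keys_add[of p q] by blast

lemma homog_uminus: "homog \<mu> d p \<Longrightarrow> homog \<mu> d (- p)"
  by (simp add: homog_def)

lemma homog_diff: "homog \<mu> d p \<Longrightarrow> homog \<mu> d q \<Longrightarrow> homog \<mu> d (p - q)"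
  using homog_add[of \<mu> d p "- q"] homog_uminus by simp

lemma homog_sum: "(\<And>x. x \<in> A \<Longrightarrow> homog \<mu> d (g x)) \<Longrightarrow> homog \<mu> d (\<Sum>x\<in>A. g x)"
  by (induction A rule: infinite_finite_induct) (auto intro: homog_add)

lemma homog_mult: "homog \<mu> d p \<Longrightarrow> homog \<mu> e q \<Longrightarrow> homog \<mu> (d + e) (p * q)"
  unfolding homog_def using keys_mult[of p q] by (fastforce simp: mon_weight_add)

lemma homog_prod:
  "(\<And>x. x \<in> A \<Longrightarrow> homog \<mu> (d x) (g x)) \<Longrightarrow> homog \<mu> (\<Sum>x\<in>A. d x) (\<Prod>x\<in>A. g x)"
  by (induction A rule: infinite_finite_induct) (auto intro: homog_mult)

lemma homog_power: "homog \<mu> d p \<Longrightarrow> homog \<mu> (int a * d) (p ^ a)"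
  by (induction a) (auto simp: algebra_simps intro: homog_mult)

lemma homog_of_int_mult: "homog \<mu> d p \<Longrightarrow> homog \<mu> d (of_int c * p)"
  using homog_mult[OF homog_Const[of \<mu> "of_int c"], of d p] by (simp add: Const_def)

text \<open>The terms of the wrong weight in the cofactor only contribute terms of the wrong weight to the
  product, so their product with the divisor vanishes.\<close>
lemma homog_cofactor:
  assumes D: "homog \<mu> e D" "D \<noteq> 0" and gD: "homog \<mu> d (g * D)"
  shows "homog \<mu> (d - e) g"
proof -
  define good where "good = {m \<in> Poly_Mapping.keys g. int (mon_weight \<mu> m) = d - e}"
  define t where "t m = Poly_Mapping.single m (Poly_Mapping.lookup g m)" for m
  define g1 where "g1 = (\<Sum>m\<in>good. t m)"
  define g2 where "g2 = (\<Sum>m\<in>Poly_Mapping.keys g - good. t m)"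
  have "good \<subseteq> Poly_Mapping.keys g" by (auto simp: good_def)
  then have g: "g = g1 + g2"
    using sum.subset_diff[of good "Poly_Mapping.keys g" t] sum_monomials[of g]
    by (simp add: g1_def g2_def t_def add.commute)
  have g1: "homog \<mu> (d - e) g1"
    unfolding g1_def by (rule homog_sum) (auto simp: t_def good_def homog_def)
  have "Poly_Mapping.keys g2 \<subseteq> (\<Union>m\<in>Poly_Mapping.keys g - good. Poly_Mapping.keys (t m))"
    unfolding g2_def by (rule keys_sum)
  then have keys_g2: "int (mon_weight \<mu> m) \<noteq> d - e" if "m \<in> Poly_Mapping.keys g2" for m
    using that by (force simp: t_def good_def split: if_splits)
  have "homog \<mu> d (g2 * D)"
    using homog_diff[OF gD, of "g1 * D"] homog_mult[OF g1 D(1)] by (simp add: g algebra_simps)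
  moreover have "int (mon_weight \<mu> m) \<noteq> d" if "m \<in> Poly_Mapping.keys (g2 * D)" for m
  proof -
    from that keys_mult[of g2 D] obtain a b
      where "a \<in> Poly_Mapping.keys g2" "b \<in> Poly_Mapping.keys D" "m = a + b" by blast
    then show ?thesis using keys_g2[of a] D(1) by (fastforce simp: homog_def mon_weight_add)
  qed
  ultimately have "Poly_Mapping.keys (g2 * D) = {}" unfolding homog_def by blast
  then have "g2 = 0" using D(2) by simp
  then show ?thesis using g g1 by simp
qed

lemma homog_2_negative_imp_0: "homog (\<lambda>_. 2) d p \<Longrightarrow> d < 0 \<Longrightarrow> p = 0"
  by (rule poly_mapping_eqI) (force simp: homog_def in_keys_iff)

lemma homog_2_0_imp_Const:
  assumes "homog (\<lambda>_. 2) 0 p"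
  obtains c where "p = Const c"
proof -
  have "m = 0" if "m \<in> Poly_Mapping.keys p" for m
  proof -
    have "mon_weight (\<lambda>_. 2) m = 0" using assms that by (auto simp: homog_def)
    then show ?thesis by (intro poly_mapping_eqI) (auto simp: mon_weight_def in_keys_iff)
  qed
  then have "p = Const (Poly_Mapping.lookup p 0)"
    by (intro poly_mapping_eqI) (auto simp: Const_def lookup_single when_def in_keys_iff)
  then show ?thesis by (rule that)
qed

lemma polys_in_closed:
  shows "0 \<in> polys_in V" "1 \<in> polys_in V" "Const c \<in> polys_in V"
    "p \<in> polys_in V \<Longrightarrow> q \<in> polys_in V \<Longrightarrow> p + q \<in> polys_in V"
    "p \<in> polys_in V \<Longrightarrow> q \<in> polys_in V \<Longrightarrow> p - q \<in> polys_in V"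
    "p \<in> polys_in V \<Longrightarrow> - p \<in> polys_in V"
    "p \<in> polys_in V \<Longrightarrow> q \<in> polys_in V \<Longrightarrow> p * q \<in> polys_in V"
    "p \<in> polys_in V \<Longrightarrow> p ^ a \<in> polys_in V"
    "(\<And>x. x \<in> A \<Longrightarrow> g x \<in> polys_in V) \<Longrightarrow> (\<Sum>x\<in>A. g x) \<in> polys_in V"
    "(\<And>x. x \<in> A \<Longrightarrow> g x \<in> polys_in V) \<Longrightarrow> (\<Prod>x\<in>A. g x) \<in> polys_in V"
  unfolding polys_in_iff_homog
  using homog_mult[of _ 0 p 0 q] homog_power[of _ 0 p a] homog_prod[of A _ "\<lambda>_. 0" g]
  by (auto intro: homog_add homog_diff homog_uminus homog_sum)

lemma Var_in_polys_in: "i \<in> V \<Longrightarrow> Var i \<in> polys_in V"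
  by (simp add: polys_in_def Var_def)

lemma polys_in_mono: "p \<in> polys_in V \<Longrightarrow> V \<subseteq> W \<Longrightarrow> p \<in> polys_in W"
  by (auto simp: polys_in_def)

lemma polys_in_cofactor:
  "g * D \<in> polys_in V \<Longrightarrow> D \<in> polys_in V \<Longrightarrow> D \<noteq> 0 \<Longrightarrow> g \<in> polys_in V"
  unfolding polys_in_iff_homog using homog_cofactor[of _ 0 D 0 g] by simp

lemma rename_mon_cong:
  "(\<And>i. i \<in> Poly_Mapping.keys m \<Longrightarrow> f i = g i) \<Longrightarrow> rename_mon f m = rename_mon g m"
  by (simp add: rename_mon_def)

lemma rename_cong:
  assumes "p \<in> polys_in V" "\<And>i. i \<in> V \<Longrightarrow> f i = g i"
  shows "rename f p = rename g p"
  unfolding rename_def using assms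
  by (intro sum.cong arg_cong2[where f = Poly_Mapping.single] rename_mon_cong) (auto simp: polys_in_def)

lemma rename_in_polys_in:
  assumes "p \<in> polys_in V" "f ` V \<subseteq> W"
  shows "rename f p \<in> polys_in W"
proof -
  have "Poly_Mapping.single (rename_mon f m) c \<in> polys_in W" if "m \<in> Poly_Mapping.keys p" for m c
  proof -
    have "Poly_Mapping.keys (rename_mon f m) \<subseteq> f ` Poly_Mapping.keys m"
      unfolding rename_mon_def using keys_sum by (fastforce split: if_splits)
    then show ?thesis using that assms by (fastforce simp: polys_in_def split: if_splits)
  qed
  then show ?thesis unfolding rename_def by (intro polys_in_closed)
qed


section \<open>Divisibility by differences of variables\<close>

text \<open>A ring endomorphism that fixes the variables modulo an ideal fixes every polynomial modulo it.\<close>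
lemma diff_dvd_rename_diff: "Var i - Var j dvd p - rename (id(j := i)) p"
proof (induction p rule: mpoly_ring_induct)
  case (Var a)
  have "Var j - Var i = - (Var i - Var j)" by simp
  then have neg: "Var i - Var j dvd Var j - Var i" by (metis dvd_minus_iff dvd_refl)
  show ?case
  proof (cases "a = j")
    case True
    then have "Var a - rename (id(j := i)) (Var a) = Var j - Var i" by simp
    then show ?thesis using neg by (rule ssubst)
  next
    case False
    then have "Var a - rename (id(j := i)) (Var a) = 0" by simp
    then show ?thesis by (rule ssubst) (rule dvd_0_right)
  qed
next
  case (add p q)
  have "p + q - rename (id(j := i)) (p + q) =
      (p - rename (id(j := i)) p) + (q - rename (id(j := i)) q)"
    by (simp add: rename_add)
  then show ?case using dvd_add[OF add] by (rule ssubst)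
next
  case (mult p q)
  have "p * q - rename (id(j := i)) (p * q) =
      p * (q - rename (id(j := i)) q) + (p - rename (id(j := i)) p) * rename (id(j := i)) q"
    by (simp add: rename_mult algebra_simps)
  then show ?case using dvd_add[OF dvd_mult[OF mult(2)] dvd_mult2[OF mult(1)]] by (rule ssubst)
qed simp

lemma diff_dvd_iff:
  assumes "i \<noteq> j"
  shows "Var i - Var j dvd p \<longleftrightarrow> rename (id(j := i)) p = 0"
proof
  assume "Var i - Var j dvd p"
  then show "rename (id(j := i)) p = 0"
    using assms by (auto simp: dvd_def rename_mult rename_diff)
next
  assume "rename (id(j := i)) p = 0"
  then show "Var i - Var j dvd p" using diff_dvd_rename_diff[of i j p] by simp
qed

text \<open>The differences are primes no two of which are associated: equating \<open>z\<^sub>a\<close> and \<open>z\<^sub>b\<close> kills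
  \<open>z\<^sub>a - z\<^sub>b\<close> but none of the others, so it divides the cofactor that the others leave.\<close>
lemma prod_diff_dvd:
  assumes "finite P" "\<And>i j. (i, j) \<in> P \<Longrightarrow> i < j" "\<And>i j. (i, j) \<in> P \<Longrightarrow> Var i - Var j dvd p"
  shows "(\<Prod>(i, j)\<in>P. Var i - Var j) dvd p"
  using assms
proof (induction P)
  case (insert x P)
  obtain a b where x: "x = (a, b)" by (cases x)
  have ab: "a < b" using insert.prems(1) x by auto
  define f where "f = (id(b := a) :: nat \<Rightarrow> nat)"
  have "(\<Prod>(i, j)\<in>P. Var i - Var j) dvd p" using insert by auto
  then obtain q where q: "p = (\<Prod>(i, j)\<in>P. Var i - Var j) * q" by (auto simp: dvd_def)
  have ne: "rename f (case y of (i, j) \<Rightarrow> Var i - Var j) \<noteq> 0" if "y \<in> P" for y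
  proof -
    obtain i j where y: "y = (i, j)" by (cases y)
    have "i < j" "(i, j) \<noteq> (a, b)" using insert that x y by auto
    then have "f i \<noteq> f j" using ab by (auto simp: f_def)
    then show ?thesis by (simp add: y rename_diff)
  qed
  have "rename f p = 0"
    using insert.prems(2)[of a b] diff_dvd_iff[of a b p] ab x by (simp add: f_def)
  then have "rename f q = 0"
    using ne insert.hyps(1) by (auto simp: q rename_mult rename_prod)
  then have "Var a - Var b dvd q" using diff_dvd_iff[of a b q] ab by (simp add: f_def)
  then have "(Var a - Var b) * (\<Prod>(i, j)\<in>P. Var i - Var j) dvd q * (\<Prod>(i, j)\<in>P. Var i - Var j)"
    by (rule mult_dvd_mono) simp
  moreover have "(\<Prod>(i, j)\<in>insert x P. Var i - Var j) = (Var a - Var b) * (\<Prod>(i, j)\<in>P. Var i - Var j)"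
    using insert.hyps by (simp add: x)
  moreover have "p = q * (\<Prod>(i, j)\<in>P. Var i - Var j)" by (simp add: q mult.commute)
  ultimately show ?case by (simp only:)
qed simp


section \<open>The Vandermonde determinant\<close>

lemma det_scale_rows:
  "det (mat n n (\<lambda>(i, j). c i * f i j)) = (\<Prod>i<n. c i) * det (mat n n (\<lambda>(i, j). f i j))"
  by (auto simp: det_def permutes_in_image prod.distrib sum_distrib_left lessThan_atLeast0
      intro!: sum.cong)

lemma det_permute_columns:
  assumes "A \<in> carrier_mat n n" and q: "q permutes {0..<n}"
  shows "det (mat n n (\<lambda>(i, j). A $$ (i, q j))) = signof q * det A"
proof -
  have "q j < n" if "j < n" for j using permutes_in_image[OF q, of j] that by simp
  then have "transpose_mat (mat n n (\<lambda>(i, j). A $$ (i, q j)))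
      = mat n n (\<lambda>(i, j). transpose_mat A $$ (q i, j))"
    using assms(1) by (intro eq_matI) auto
  then show ?thesis
    using det_transpose[of "mat n n (\<lambda>(i, j). A $$ (i, q j))" n]
      det_permute_rows[of "transpose_mat A" n q] det_transpose[OF assms(1)] assms by simp
qed

text \<open>Subtracting \<open>x 0\<close> times the next column from every column clears the first row up to its last entry
  and exposes the factor \<open>x i - x 0\<close> in row \<open>i\<close>.\<close>
lemma det_vandermonde:
  fixes x :: "nat \<Rightarrow> 'a::comm_ring_1"
  shows "det (mat n n (\<lambda>(i, j). x i ^ (n - Suc j))) = (\<Prod>i<n. \<Prod>j\<in>{i<..<n}. x i - x j)"
proof (induction n arbitrary: x)
  case 0
  show ?case by (simp add: det_def)
next
  case (Suc n)
  define M where "M = mat (Suc n) (Suc n) (\<lambda>(i, j). x i ^ (n - j))"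
  \<comment> \<open>Right multiplication by \<open>U\<close> performs the column operations.\<close>
  define U where "U = mat (Suc n) (Suc n) (\<lambda>(i, j). if i = j then 1 else if i = Suc j then - x 0 else 0)"
  define N where "N = mat (Suc n) (Suc n) (\<lambda>(i, j). if j < n then (x i - x 0) * x i ^ (n - Suc j) else 1)"
  have carrier: "M \<in> carrier_mat (Suc n) (Suc n)" "U \<in> carrier_mat (Suc n) (Suc n)"
    "N \<in> carrier_mat (Suc n) (Suc n)"
    by (simp_all add: M_def U_def N_def)
  have "det U = prod_list (diag_mat U)"
    by (rule det_lower_triangular[OF _ carrier(2)]) (auto simp: U_def)
  also have "diag_mat U = replicate (Suc n) 1"
    by (rule nth_equalityI) (auto simp: diag_mat_def U_def simp del: upt_Suc replicate_Suc)
  finally have detU: "det U = 1" by simp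
  have MU: "M * U = N"
  proof (rule eq_matI)
    fix i j assume "i < dim_row N" "j < dim_col N"
    then have ij: "i < Suc n" "j < Suc n" by (auto simp: N_def)
    have "(M * U) $$ (i, j) = (\<Sum>r<Suc n. x i ^ (n - r) * U $$ (r, j))"
      using ij carrier by (simp add: M_def U_def scalar_prod_def lessThan_atLeast0)
    also have "\<dots> = (\<Sum>r<Suc n. (if r = j then x i ^ (n - j) else 0)
        + (if r = Suc j then - (x i ^ (n - Suc j) * x 0) else 0))"
      using ij by (intro sum.cong) (auto simp: U_def)
    also have "\<dots> = x i ^ (n - j) + (if j < n then - (x i ^ (n - Suc j) * x 0) else 0)"
      using ij by (simp add: sum.distrib del: sum.lessThan_Suc)
    also have "\<dots> = N $$ (i, j)"
    proof (cases "j < n")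
      case True
      then have "n - j = Suc (n - Suc j)" by simp
      then show ?thesis using ij True by (simp add: N_def algebra_simps)
    next
      case False
      then show ?thesis using ij by (simp add: N_def)
    qed
    finally show "(M * U) $$ (i, j) = N $$ (i, j)" .
  qed (use carrier in auto)
  have "det M = det N"
    using det_mult[OF carrier(1,2)] detU MU by simp
  also have "\<dots> = (\<Sum>j<Suc n. N $$ (0, j) * cofactor N 0 j)"
    by (rule laplace_expansion_row[OF carrier(3)]) simp
  also have "\<dots> = cofactor N 0 n"
    by (simp add: N_def)
  also have "mat_delete N 0 n = mat n n (\<lambda>(i, j). (x (Suc i) - x 0) * x (Suc i) ^ (n - Suc j))"
    by (rule eq_matI) (auto simp: mat_delete_def N_def)
  then have "cofactor N 0 n = (-1) ^ n * ((\<Prod>i<n. x (Suc i) - x 0) *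
      det (mat n n (\<lambda>(i, j). x (Suc i) ^ (n - Suc j))))"
    by (simp add: cofactor_def det_scale_rows)
  also have "\<dots> = (\<Prod>i<n. x 0 - x (Suc i)) * (\<Prod>i<n. \<Prod>j\<in>{i<..<n}. x (Suc i) - x (Suc j))"
  proof -
    have "(-1) ^ n * (\<Prod>i<n. x (Suc i) - x 0) = (\<Prod>i<n. (-1) * (x (Suc i) - x 0))"
      by (subst prod.distrib) simp
    then show ?thesis using Suc[of "\<lambda>i. x (Suc i)"] by (simp add: mult.assoc[symmetric])
  qed
  also have "\<dots> = (\<Prod>i<Suc n. \<Prod>j\<in>{i<..<Suc n}. x i - x j)"
  proof -
    have "{0<..<Suc n} = Suc ` {..<n}" "{Suc i<..<Suc n} = Suc ` {i<..<n}" for i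
      by (force simp: image_iff gr0_conv_Suc Suc_less_eq2)+
    then show ?thesis
      by (simp add: prod.lessThan_Suc_shift prod.reindex del: prod.lessThan_Suc)
  qed
  finally show ?case by (simp add: M_def)
qed


section \<open>Laplace expansion along a block of rows\<close>

text \<open>For weakly increasing \<open>a\<close> with values at most \<open>l\<close>, the permutation that is increasing on the first
  \<open>k\<close> and on the last \<open>l\<close> positions and sends \<open>i < k\<close> to \<open>a i + i\<close>.\<close>
definition shuffle :: "nat \<Rightarrow> nat \<Rightarrow> (nat \<Rightarrow> nat) \<Rightarrow> nat \<Rightarrow> nat" where
  "shuffle k l a i =
     (if i < k then a i + i
      else if i < k + l then i - k + card {j. j < k \<and> a j \<le> i - k} else i)"

text \<open>Lowering the first nonzero value of \<open>a\<close> by one exchanges two adjacent values of the shuffle, and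
  the shuffle of the zero function is the identity.\<close>
lemma shuffle_permutes_sign:
  assumes "\<And>i j. i \<le> j \<Longrightarrow> j < k \<Longrightarrow> a i \<le> a j" "\<And>i. i < k \<Longrightarrow> a i \<le> l"
  shows "shuffle k l a permutes {0..<k + l} \<and> sign (shuffle k l a) = (- 1) ^ (\<Sum>i<k. a i)"
  using assms
proof (induction "\<Sum>i<k. a i" arbitrary: a)
  case 0
  then have "a i = 0" if "i < k" for i using that by simp
  moreover have "{j. j < k} = {..<k}" by auto
  ultimately have "shuffle k l a = id"
    by (auto simp: shuffle_def fun_eq_iff cong: conj_cong)
  then show ?case using 0(1) permutes_id[of "{0..<k + l}"] by (simp add: id_def)
next
  case (Suc s)
  have "\<exists>i. i < k \<and> a i > 0"
  proof (rule ccontr)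
    assume "\<not> (\<exists>i. i < k \<and> a i > 0)"
    then have "(\<Sum>i<k. a i) = 0" by simp
    then show False using Suc(2) by simp
  qed
  define j where "j = (LEAST i. i < k \<and> a i > 0)"
  have j: "j < k" "a j > 0"
    using LeastI_ex[OF \<open>\<exists>i. i < k \<and> a i > 0\<close>] by (auto simp: j_def)
  have zero: "a i = 0" if "i < j" for i
    using not_less_Least[of i "\<lambda>i. i < k \<and> a i > 0"] that j by (auto simp: j_def)
  define b where "b = a(j := a j - 1)"
  have sum_b: "Suc (\<Sum>i<k. b i) = (\<Sum>i<k. a i)"
    using j by (simp add: b_def sum.remove[of "{..<k}" j])
  have b_mono: "b i \<le> b i'" if "i \<le> i'" "i' < k" for i i'
    using Suc.prems(1)[OF that] Suc.prems(1)[of j i'] zero[of i] that by (auto simp: b_def)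
  have b_le: "b i \<le> l" if "i < k" for i
    using Suc.prems(2)[OF that] by (auto simp: b_def)
  have IH: "shuffle k l b permutes {0..<k + l}" "sign (shuffle k l b) = (- 1) ^ (\<Sum>i<k. b i)"
    using Suc(1)[of b] Suc(2) sum_b b_mono b_le by auto
  \<comment> \<open>The position in the second block whose value is just below the value at \<open>j\<close>.\<close>
  define c where "c = k + (a j - 1)"
  have c: "c < k + l" "j \<noteq> c" using j Suc.prems(2)[of j] by (auto simp: c_def)
  have less: "j' < k \<and> a j' \<le> a j - 1 \<longleftrightarrow> j' < j" for j'
    using zero[of j'] Suc.prems(1)[of j j'] j by (cases "j' < j") auto
  have less': "j' < k \<and> b j' \<le> a j - 1 \<longleftrightarrow> j' \<le> j" for j'
    using less[of j'] j by (cases "j' = j") (auto simp: b_def)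
  have "{j'. j' < k \<and> a j' \<le> a j - 1} = {..<j}"
    unfolding less by auto
  moreover have "{j'. j' < k \<and> b j' \<le> a j - 1} = {..j}"
    unfolding less' by auto
  moreover have "{j'. j' < k \<and> b j' \<le> m} = {j'. j' < k \<and> a j' \<le> m}" if "m \<noteq> a j - 1" for m
    using that j by (auto simp: b_def split: if_splits)
  ultimately have eq: "shuffle k l a = shuffle k l b \<circ> transpose j c"
    using c j by (fastforce simp: fun_eq_iff shuffle_def transpose_def c_def b_def)
  have tr: "transpose j c permutes {0..<k + l}"
    using c j by (intro permutes_swap_id) auto
  have "sign (shuffle k l a) = sign (shuffle k l b) * sign (transpose j c)"
    unfolding eq using IH(1) tr by (intro sign_compose permutes_imp_permutation) auto
  also have "\<dots> = (- 1) ^ (\<Sum>i<k. a i)"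
    using c by (simp add: IH(2) sign_swap_id flip: sum_b)
  finally show ?case
    using permutes_compose[OF tr IH(1)] eq by simp
qed

definition box_shuffle :: "nat \<Rightarrow> nat \<Rightarrow> nat list \<Rightarrow> nat \<Rightarrow> nat" where
  "box_shuffle k l \<alpha> = shuffle k l (\<lambda>i. l - \<alpha> ! i)"

lemma box_partitions_nth_mono:
  assumes "\<alpha> \<in> box_partitions k l" "i \<le> j" "j < k"
  shows "\<alpha> ! j \<le> \<alpha> ! i"
  using assms sorted_wrt_nth_less[of "(\<ge>)" \<alpha> i j] by (cases "i = j") (auto simp: box_partitions_def)

lemma box_partitions_nth_le: "\<alpha> \<in> box_partitions k l \<Longrightarrow> i < k \<Longrightarrow> \<alpha> ! i \<le> l"
  by (auto simp: box_partitions_def)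

lemma finite_box_partitions [simp]: "finite (box_partitions k l)"
proof (rule finite_subset)
  show "box_partitions k l \<subseteq> {\<alpha>. set \<alpha> \<subseteq> {..l} \<and> length \<alpha> = k}"
    by (auto simp: box_partitions_def)
qed (simp add: finite_lists_length_eq)

lemma box_shuffle_permutes_sign:
  assumes "\<alpha> \<in> box_partitions k l"
  shows "box_shuffle k l \<alpha> permutes {0..<k + l}"
    "sign (box_shuffle k l \<alpha>) = (- 1) ^ (\<Sum>i<k. l - \<alpha> ! i)"
  using shuffle_permutes_sign[of k "\<lambda>i. l - \<alpha> ! i" l] box_partitions_nth_mono[OF assms]
  by (auto simp: box_shuffle_def diff_le_mono2)

lemma strict_sorted_nth_diff:
  fixes xs :: "nat list"
  assumes "sorted_wrt (<) xs" "i \<le> j" "j < length xs"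
  shows "xs ! i + (j - i) \<le> xs ! j"
  using assms(2,3)
proof (induction j rule: dec_induct)
  case (step m)
  then show ?case using sorted_wrt_nth_less[OF assms(1), of m "Suc m"] by simp
qed simp

text \<open>A partition in the \<open>k \<times> l\<close> box is the same as the set of the \<open>k\<close> vertical steps of its boundary
  path, a path of length \<open>k + l\<close>.\<close>
lemma box_shuffle_image_bij:
  "bij_betw (\<lambda>\<alpha>. box_shuffle k l \<alpha> ` {..<k}) (box_partitions k l) {S. S \<subseteq> {..<k + l} \<and> card S = k}"
proof (rule bij_betwI')
  fix \<alpha> \<beta> assume \<alpha>: "\<alpha> \<in> box_partitions k l" and \<beta>: "\<beta> \<in> box_partitions k l"
  define steps where "steps \<gamma> = map (box_shuffle k l \<gamma>) [0..<k]" for \<gamma>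
  have set_steps: "set (steps \<gamma>) = box_shuffle k l \<gamma> ` {..<k}" for \<gamma>
    by (auto simp: steps_def)
  have sorted: "sorted_wrt (<) (steps \<gamma>)" if "\<gamma> \<in> box_partitions k l" for \<gamma>
    unfolding sorted_wrt_iff_nth_less
  proof (intro allI impI)
    fix i j assume "i < j" "j < length (steps \<gamma>)"
    then have ij: "i < j" "j < k" by (auto simp: steps_def)
    have "l - \<gamma> ! i + i < l - \<gamma> ! j + j"
      using box_partitions_nth_mono[OF that less_imp_le[OF ij(1)] ij(2)] ij
      by (intro add_le_less_mono diff_le_mono2)
    then show "steps \<gamma> ! i < steps \<gamma> ! j"
      using ij by (simp add: steps_def box_shuffle_def shuffle_def)
  qed
  show "(box_shuffle k l \<alpha> ` {..<k} = box_shuffle k l \<beta> ` {..<k}) = (\<alpha> = \<beta>)"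
  proof
    assume "box_shuffle k l \<alpha> ` {..<k} = box_shuffle k l \<beta> ` {..<k}"
    then have "steps \<alpha> = steps \<beta>"
      using sorted[OF \<alpha>] sorted[OF \<beta>] by (intro strict_sorted_equal) (simp_all add: set_steps)
    then have "box_shuffle k l \<alpha> i = box_shuffle k l \<beta> i" if "i < k" for i
      using that by (simp add: steps_def)
    then have "l - \<alpha> ! i = l - \<beta> ! i" if "i < k" for i
      using that by (simp add: box_shuffle_def shuffle_def)
    then have "\<alpha> ! i = \<beta> ! i" if "i < k" for i
      using that box_partitions_nth_le[OF \<alpha> that] box_partitions_nth_le[OF \<beta> that]
      by (metis diff_diff_cancel)
    then show "\<alpha> = \<beta>"
      using \<alpha> \<beta> by (intro nth_equalityI) (auto simp: box_partitions_def)
  qed simp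
next
  fix \<alpha> assume \<alpha>: "\<alpha> \<in> box_partitions k l"
  note perm = box_shuffle_permutes_sign(1)[OF \<alpha>]
  have "box_shuffle k l \<alpha> i < k + l" if "i < k" for i
    using permutes_in_image[OF perm, of i] that by simp
  moreover have "card (box_shuffle k l \<alpha> ` {..<k}) = k"
    using permutes_inj[OF perm] by (simp add: card_image inj_on_subset)
  ultimately show "box_shuffle k l \<alpha> ` {..<k} \<in> {S. S \<subseteq> {..<k + l} \<and> card S = k}"
    by auto
next
  fix S assume "S \<in> {S. S \<subseteq> {..<k + l} \<and> card S = k}"
  then have S: "S \<subseteq> {..<k + l}" "card S = k" "finite S"
    using finite_subset[of S "{..<k + l}"] by auto
  define xs where "xs = sorted_list_of_set S"
  have xs: "sorted_wrt (<) xs" "set xs = S" "length xs = k"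
    using S by (auto simp: xs_def)
  have lower: "i \<le> xs ! i" if "i < k" for i
    using strict_sorted_nth_diff[OF xs(1), of 0 i] that xs(3) by simp
  have upper: "xs ! i \<le> l + i" if "i < k" for i
  proof -
    have "xs ! (k - 1) < k + l" using S(1) that xs nth_mem[of "k - 1" xs] by auto
    moreover have "xs ! i + (k - 1 - i) \<le> xs ! (k - 1)"
      by (rule strict_sorted_nth_diff[OF xs(1)]) (use that xs(3) in auto)
    ultimately show ?thesis using that by linarith
  qed
  define \<alpha> where "\<alpha> = map (\<lambda>i. l + i - xs ! i) [0..<k]"
  have mono: "l + j - xs ! j \<le> l + i - xs ! i" if "i < j" "j < k" for i j
    using strict_sorted_nth_diff[OF xs(1), of i j] upper[of j] that xs(3) by linarith
  have le: "l + i - xs ! i \<le> l" if "i < k" for i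
    using lower[OF that] by linarith
  have \<alpha>: "\<alpha> \<in> box_partitions k l"
    using le mono by (auto simp: box_partitions_def \<alpha>_def sorted_wrt_iff_nth_less)
  have "box_shuffle k l \<alpha> i = xs ! i" if "i < k" for i
    using that lower[OF that] upper[OF that] by (simp add: box_shuffle_def shuffle_def \<alpha>_def)
  then have "box_shuffle k l \<alpha> ` {..<k} = (!) xs ` {..<k}" by simp
  also have "\<dots> = S" using xs by (auto simp: set_conv_nth)
  finally show "\<exists>\<alpha>\<in>box_partitions k l. S = box_shuffle k l \<alpha> ` {..<k}" using \<alpha> by blast
qed

text \<open>Masking keeps exactly those permutations of the Leibniz sum that send the first \<open>k\<close> rows to a
  prescribed set of \<open>k\<close> columns. Each permutation survives for exactly one set, and after the columns
  are sorted by the shuffle the masked matrix is block diagonal.\<close>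
lemma laplace_expansion_blocks:
  fixes A :: "'a::idom mat"
  assumes A: "A \<in> carrier_mat (k + l) (k + l)"
  shows "det A = (\<Sum>\<alpha>\<in>box_partitions k l. (- 1) ^ (\<Sum>i<k. l - \<alpha> ! i) *
    (det (mat k k (\<lambda>(i, j). A $$ (i, box_shuffle k l \<alpha> j))) *
     det (mat l l (\<lambda>(i, j). A $$ (k + i, box_shuffle k l \<alpha> (k + j))))))"
proof -
  define n where "n = k + l"
  define cols where "cols \<alpha> = box_shuffle k l \<alpha> ` {..<k}" for \<alpha>
  define mask where "mask \<alpha> = mat n n (\<lambda>(i, j). if i < k \<longleftrightarrow> j \<in> cols \<alpha> then A $$ (i, j) else 0)" for \<alpha>
  have mask_carrier: "mask \<alpha> \<in> carrier_mat n n" for \<alpha> by (simp add: mask_def)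
  have A': "A \<in> carrier_mat n n" using A by (simp add: n_def)
  have only_one: "(\<Sum>\<alpha>\<in>box_partitions k l. \<Prod>i = 0..<n. mask \<alpha> $$ (i, p i)) = (\<Prod>i = 0..<n. A $$ (i, p i))"
    if p: "p permutes {0..<n}" for p
  proof -
    have lt: "p i < n" if "i < n" for i using permutes_in_image[OF p, of i] that by simp
    have inj: "inj p" using p by (rule permutes_inj)
    have "p ` {..<k} \<subseteq> {..<k + l}" "card (p ` {..<k}) = k"
      using lt inj by (auto simp: n_def card_image inj_on_subset)
    then have "p ` {..<k} \<in> cols ` box_partitions k l"
      using bij_betw_imp_surj_on[OF box_shuffle_image_bij[of k l]] unfolding cols_def by simp
    then obtain \<alpha> where \<alpha>: "\<alpha> \<in> box_partitions k l" "cols \<alpha> = p ` {..<k}" by auto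
    have "(\<Prod>i = 0..<n. mask \<beta> $$ (i, p i)) = (if \<beta> = \<alpha> then \<Prod>i = 0..<n. A $$ (i, p i) else 0)"
      if \<beta>: "\<beta> \<in> box_partitions k l" for \<beta>
    proof (cases "\<beta> = \<alpha>")
      case True
      have "i < k \<longleftrightarrow> p i \<in> cols \<alpha>" for i using inj \<alpha>(2) by (auto simp: inj_def)
      then show ?thesis using True lt by (auto simp: mask_def intro!: prod.cong)
    next
      case False
      then have "cols \<beta> \<noteq> cols \<alpha>"
        using bij_betw_imp_inj_on[OF box_shuffle_image_bij[of k l]] \<alpha>(1) \<beta>
        unfolding cols_def by (auto simp: inj_on_def)
      moreover have "finite (cols \<beta>)" "card (cols \<alpha>) = card (cols \<beta>)"
        using bij_betwE[OF box_shuffle_image_bij[of k l]] \<alpha>(1) \<beta> by (auto simp: cols_def)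
      ultimately have "\<not> p ` {..<k} \<subseteq> cols \<beta>" using \<alpha>(2) card_subset_eq by metis
      then obtain i where "i < k" "p i \<notin> cols \<beta>" by auto
      then have "\<exists>i\<in>{0..<n}. mask \<beta> $$ (i, p i) = 0"
        using lt by (intro bexI[of _ i]) (auto simp: mask_def n_def)
      then show ?thesis using False by (simp add: prod_zero)
    qed
    then show ?thesis using \<alpha>(1) by simp
  qed
  have "det A = (\<Sum>p | p permutes {0..<n}. signof p * (\<Prod>i = 0..<n. A $$ (i, p i)))"
    by (rule det_def'[OF A'])
  also have "\<dots> = (\<Sum>p | p permutes {0..<n}.
      \<Sum>\<alpha>\<in>box_partitions k l. signof p * (\<Prod>i = 0..<n. mask \<alpha> $$ (i, p i)))"
    by (intro sum.cong refl) (simp add: only_one flip: sum_distrib_left)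
  also have "\<dots> = (\<Sum>\<alpha>\<in>box_partitions k l. det (mask \<alpha>))"
    by (subst sum.swap) (simp add: det_def'[OF mask_carrier])
  also have "\<dots> = (\<Sum>\<alpha>\<in>box_partitions k l. (- 1) ^ (\<Sum>i<k. l - \<alpha> ! i) *
    (det (mat k k (\<lambda>(i, j). A $$ (i, box_shuffle k l \<alpha> j))) *
     det (mat l l (\<lambda>(i, j). A $$ (k + i, box_shuffle k l \<alpha> (k + j))))))"
  proof (intro sum.cong refl)
    fix \<alpha> assume \<alpha>: "\<alpha> \<in> box_partitions k l"
    define q where "q = box_shuffle k l \<alpha>"
    have q: "q permutes {0..<n}" "sign q = (- 1) ^ (\<Sum>i<k. l - \<alpha> ! i)"
      using box_shuffle_permutes_sign[OF \<alpha>] by (simp_all add: q_def n_def)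
    have lt: "q i < n" if "i < n" for i using permutes_in_image[OF q(1), of i] that by simp
    have cols: "q j \<in> cols \<alpha> \<longleftrightarrow> j < k" for j
      using permutes_inj[OF q(1)] by (auto simp: cols_def q_def[symmetric] inj_def)
    define B where "B = mat k k (\<lambda>(i, j). A $$ (i, q j))"
    define C where "C = mat l l (\<lambda>(i, j). A $$ (k + i, q (k + j)))"
    have blocks: "mat n n (\<lambda>(i, j). mask \<alpha> $$ (i, q j)) = four_block_mat B (0\<^sub>m k l) (0\<^sub>m l k) C"
      by (rule eq_matI) (auto simp: mask_def B_def C_def n_def lt[unfolded n_def] cols)
    have "det B * det C = signof q * det (mask \<alpha>)"
      using det_permute_columns[OF mask_carrier q(1), of \<alpha>] unfolding blocks
      by (subst (asm) det_four_block_mat_upper_right_zero) (auto simp: B_def C_def)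
    then have "det (mask \<alpha>) = signof q * (det B * det C)"
      by (simp add: mult.assoc[symmetric] flip: of_int_mult)
    also have "signof q = ((- 1) ^ (\<Sum>i<k. l - \<alpha> ! i) :: 'a)" by (simp add: q(2))
    finally show "det (mask \<alpha>) = (- 1) ^ (\<Sum>i<k. l - \<alpha> ! i) *
      (det (mat k k (\<lambda>(i, j). A $$ (i, box_shuffle k l \<alpha> j))) *
       det (mat l l (\<lambda>(i, j). A $$ (k + i, box_shuffle k l \<alpha> (k + j)))))"
      by (simp add: B_def C_def q_def)
  qed
  finally show ?thesis .
qed


section \<open>Schur polynomials\<close>

interpretation rename_hom: comm_ring_hom "rename f" for f
  by unfold_locales (simp_all add: rename_add rename_mult)

lemma rename_det:
  "rename f (det (mat n n (\<lambda>(i, j). g i j))) = det (mat n n (\<lambda>(i, j). rename f (g i j)))"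
proof -
  have "map_mat (rename f) (mat n n (\<lambda>(i, j). g i j)) = mat n n (\<lambda>(i, j). rename f (g i j))"
    by (rule eq_matI) auto
  then show ?thesis by (metis rename_hom.hom_det)
qed

lemma vandermonde_altdef:
  "vandermonde s n = (\<Prod>(i, j)\<in>{(i, j). s < i \<and> i < j \<and> j \<le> s + n}. Var i - Var j)"
  unfolding vandermonde_def
  by (rule prod.reindex_bij_witness[of _ "\<lambda>(i, j). (i - s, j - s)" "\<lambda>(i, j). (s + i, s + j)"]) auto

lemma finite_ordered_pairs [simp]: "finite {(i, j). s < i \<and> i < j \<and> j \<le> (t::nat)}"
  by (rule finite_subset[of _ "{..t} \<times> {..t}"]) auto

lemma vandermonde_nonzero: "vandermonde s n \<noteq> 0"
  unfolding vandermonde_altdef by (subst prod_zero_iff) auto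

lemma vandermonde_eq_alternant: "vandermonde s n = alternant s (replicate n 0)"
proof -
  have "alternant s (replicate n 0) = det (mat n n (\<lambda>(i, j). Var (s + Suc i) ^ (n - Suc j)))"
    unfolding alternant_def Let_def length_replicate
    by (intro arg_cong[where f = det] eq_matI) auto
  also have "\<dots> = (\<Prod>i<n. \<Prod>j\<in>{i<..<n}. Var (s + Suc i) - Var (s + Suc j))"
    by (rule det_vandermonde)
  also have "\<dots> = (\<Prod>(i, j)\<in>(SIGMA i:{..<n}. {i<..<n}). Var (s + Suc i) - Var (s + Suc j))"
    by (rule prod.Sigma) auto
  also have "\<dots> = vandermonde s n"
    unfolding vandermonde_def
    by (rule prod.reindex_bij_witness[of _ "\<lambda>(i, j). (i - 1, j - 1)" "\<lambda>(i, j). (Suc i, Suc j)"]) auto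
  finally show ?thesis by simp
qed

lemma alternant_leibniz:
  "alternant s \<alpha> = (\<Sum>p | p permutes {0..<length \<alpha>}. signof p *
     (\<Prod>i<length \<alpha>. Var (s + Suc i) ^ (\<alpha> ! p i + length \<alpha> - Suc (p i))))"
  unfolding alternant_def Let_def
  by (subst det_def'[where n = "length \<alpha>"])
     (auto intro!: sum.cong prod.cong simp: lessThan_atLeast0 permutes_in_image)

lemma alternant_in_polys_in: "alternant s \<alpha> \<in> polys_in {s + 1..s + length \<alpha>}"
proof -
  have "signof p * (\<Prod>i<length \<alpha>. Var (s + Suc i) ^ e i) \<in> polys_in {s + 1..s + length \<alpha>}" for p e
    by (intro polys_in_closed Var_in_polys_in) (auto simp: sign_def intro: polys_in_closed)
  then show ?thesis unfolding alternant_leibniz by (intro polys_in_closed(9))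
qed

lemma homog_alternant:
  "homog (\<lambda>_. 2) (2 * (\<Sum>j<length \<alpha>. int (\<alpha> ! j + length \<alpha> - Suc j))) (alternant s \<alpha>)"
  unfolding alternant_leibniz
proof (rule homog_sum)
  fix p assume "p \<in> {p. p permutes {0..<length \<alpha>}}"
  then have p: "p permutes {..<length \<alpha>}" by (simp add: lessThan_atLeast0)
  have "homog (\<lambda>_. 2) (\<Sum>i<length \<alpha>. int (\<alpha> ! p i + length \<alpha> - Suc (p i)) * 2)
      (\<Prod>i<length \<alpha>. Var (s + Suc i) ^ (\<alpha> ! p i + length \<alpha> - Suc (p i)))"
    using homog_power[OF homog_Var[of "\<lambda>_. 2"]] by (intro homog_prod) simp
  also have "(\<Sum>i<length \<alpha>. int (\<alpha> ! p i + length \<alpha> - Suc (p i)) * 2)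
      = (\<Sum>j<length \<alpha>. int (\<alpha> ! j + length \<alpha> - Suc j) * 2)"
    using sum.permute[OF p, of "\<lambda>j. int (\<alpha> ! j + length \<alpha> - Suc j) * 2"] by (simp add: o_def)
  finally show "homog (\<lambda>_. 2) (2 * (\<Sum>j<length \<alpha>. int (\<alpha> ! j + length \<alpha> - Suc j)))
    (signof p * (\<Prod>i<length \<alpha>. Var (s + Suc i) ^ (\<alpha> ! p i + length \<alpha> - Suc (p i))))"
    by (intro homog_of_int_mult) (simp add: sum_distrib_left mult.commute)
qed

text \<open>Transpositions generate, and each of them exchanges two rows of the determinant.\<close>
lemma rename_alternant:
  assumes "\<sigma> permutes {s + 1..s + length \<alpha>}"
  shows "rename \<sigma> (alternant s \<alpha>) = signof \<sigma> * alternant s \<alpha>"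
  using assms finite_atLeastAtMost
proof (induction rule: permutes_induct)
  case id
  then show ?case by (simp add: rename_id[unfolded id_def])
next
  case (swap a b p)
  define n where "n = length \<alpha>"
  define A where "A = mat n n (\<lambda>(i, j). Var (s + Suc i) ^ (\<alpha> ! j + n - Suc j))"
  define a' b' where "a' = a - Suc s" "b' = b - Suc s"
  have ab: "a = s + Suc a'" "b = s + Suc b'" "a' < n" "b' < n" "a' \<noteq> b'"
    using swap.hyps by (auto simp: a'_b'_def n_def)
  have A: "alternant s \<alpha> = det A" by (simp add: alternant_def A_def n_def Let_def)
  have lt: "Transposition.transpose a' b' i < n" if "i < n" for i
    using ab that by (auto simp: transpose_def)
  have "rename (Transposition.transpose a b) (alternant s \<alpha>)
      = det (mat n n (\<lambda>(i, j). A $$ (Transposition.transpose a' b' i, j)))"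
    unfolding A unfolding A_def rename_det
    by (intro arg_cong[where f = det] eq_matI)
       (use lt in \<open>auto simp: rename_power ab(1,2) transpose_def\<close>)
  also have "\<dots> = signof (Transposition.transpose a' b') * det A"
    by (rule det_permute_rows) (use ab in \<open>auto simp: A_def intro!: permutes_swap_id\<close>)
  finally have tr: "rename (Transposition.transpose a b) (alternant s \<alpha>) = - alternant s \<alpha>"
    using ab A by (simp add: sign_swap_id)
  have "permutation p" using swap.hyps permutes_imp_permutation[of _ p] by blast
  then have sign: "sign (Transposition.transpose a b \<circ> p) = - sign p"
    using swap.hyps by (simp only: sign_compose permutation_swap_id) (simp add: sign_swap_id)
  have "rename (Transposition.transpose a b \<circ> p) (alternant s \<alpha>)
      = rename (Transposition.transpose a b) (rename p (alternant s \<alpha>))"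
    by (rule rename_rename[symmetric])
  also have "\<dots> = signof p * - alternant s \<alpha>"
    by (simp only: swap.IH rename_mult rename_of_int tr)
  finally show ?case
    by (simp only: sign of_int_minus mult_minus_left mult_minus_right)
qed

lemma rename_vandermonde:
  "\<sigma> permutes {s + 1..s + n} \<Longrightarrow> rename \<sigma> (vandermonde s n) = signof \<sigma> * vandermonde s n"
  using rename_alternant[of \<sigma> s "replicate n 0"] by (simp add: vandermonde_eq_alternant)

lemma vandermonde_in_polys_in: "vandermonde s n \<in> polys_in {s + 1..s + n}"
  using alternant_in_polys_in[of s "replicate n 0"] by (simp add: vandermonde_eq_alternant)

lemma vandermonde_dvdI:
  assumes "\<And>i j. s < i \<Longrightarrow> i < j \<Longrightarrow> j \<le> s + n \<Longrightarrow> rename (id(j := i)) p = 0"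
  shows "vandermonde s n dvd p"
  unfolding vandermonde_altdef
proof (rule prod_diff_dvd)
  fix i j assume "(i, j) \<in> {(i, j). s < i \<and> i < j \<and> j \<le> s + n}"
  then show "Var i - Var j dvd p" using assms[of i j] by (intro diff_dvd_iff[THEN iffD2]) auto
qed auto

text \<open>Equating two variables makes two rows of the alternant equal, so each difference divides it; the
  quotient is unique by cancellation, which makes the definite description denote it.\<close>
lemma schur_mult_vandermonde: "schur s \<alpha> * vandermonde s (length \<alpha>) = alternant s \<alpha>"
proof -
  have "vandermonde s (length \<alpha>) dvd alternant s \<alpha>"
  proof (rule vandermonde_dvdI)
    fix i j assume ij: "s < i" "i < j" "j \<le> s + length \<alpha>"
    define n where "n = length \<alpha>"
    define A where "A = mat n n (\<lambda>(a, b). rename (id(j := i)) (Var (s + Suc a) ^ (\<alpha> ! b + n - Suc b)))"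
    have "row A (i - Suc s) = row A (j - Suc s)"
      using ij by (intro eq_vecI) (auto simp: A_def n_def rename_power)
    then have "det A = 0"
      using ij by (intro det_identical_rows[of A n "i - Suc s" "j - Suc s"]) (auto simp: A_def n_def)
    then show "rename (id(j := i)) (alternant s \<alpha>) = 0"
      by (simp add: alternant_def Let_def rename_det A_def n_def)
  qed
  then obtain q where q: "alternant s \<alpha> = vandermonde s (length \<alpha>) * q" by (rule dvdE)
  show ?thesis
    unfolding schur_def
  proof (rule theI[of _ q])
    show "q * vandermonde s (length \<alpha>) = alternant s \<alpha>" by (simp add: q mult.commute)
    show "r = q" if "r * vandermonde s (length \<alpha>) = alternant s \<alpha>" for r
      using that vandermonde_nonzero[of s "length \<alpha>"] unfolding q
      by (metis mult.commute mult_cancel_right)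
  qed
qed

lemma schur_in_polys_in: "schur s \<alpha> \<in> polys_in {s + 1..s + length \<alpha>}"
  by (rule polys_in_cofactor[of _ "vandermonde s (length \<alpha>)"])
     (simp_all add: schur_mult_vandermonde alternant_in_polys_in vandermonde_in_polys_in vandermonde_nonzero
        del: One_nat_def add_Suc_right)

lemma rename_schur:
  assumes "\<sigma> permutes {s + 1..s + length \<alpha>}"
  shows "rename \<sigma> (schur s \<alpha>) = schur s \<alpha>"
proof -
  have "rename \<sigma> (schur s \<alpha>) * (signof \<sigma> * vandermonde s (length \<alpha>))
      = rename \<sigma> (schur s \<alpha> * vandermonde s (length \<alpha>))"
    using assms by (simp only: rename_mult rename_vandermonde)
  also have "\<dots> = schur s \<alpha> * (signof \<sigma> * vandermonde s (length \<alpha>))"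
    using rename_alternant[OF assms] by (simp add: ac_simps flip: schur_mult_vandermonde)
  finally show ?thesis
    using vandermonde_nonzero[of s "length \<alpha>"] by (cases \<sigma> rule: sign_cases) auto
qed

lemma homog_schur: "homog (\<lambda>_. 2) (2 * int (sum_list \<alpha>)) (schur s \<alpha>)"
proof -
  define n where "n = length \<alpha>"
  have "homog (\<lambda>_. 2) (2 * (\<Sum>j<n. int (\<alpha> ! j + n - Suc j)) - 2 * (\<Sum>j<n. int (n - Suc j))) (schur s \<alpha>)"
  proof (rule homog_cofactor)
    show "homog (\<lambda>_. 2) (2 * (\<Sum>j<n. int (n - Suc j))) (vandermonde s n)"
      using homog_alternant[of "replicate n 0" s] by (simp add: vandermonde_eq_alternant)
    show "homog (\<lambda>_. 2) (2 * (\<Sum>j<n. int (\<alpha> ! j + n - Suc j))) (schur s \<alpha> * vandermonde s n)"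
      using homog_alternant[of \<alpha> s] by (simp add: n_def schur_mult_vandermonde)
  qed (rule vandermonde_nonzero)
  also have "2 * (\<Sum>j<n. int (\<alpha> ! j + n - Suc j)) - 2 * (\<Sum>j<n. int (n - Suc j))
      = 2 * (\<Sum>j<n. int (\<alpha> ! j + n - Suc j) - int (n - Suc j))"
    by (simp only: sum_subtractf right_diff_distrib)
  also have "(\<Sum>j<n. int (\<alpha> ! j + n - Suc j) - int (n - Suc j)) = (\<Sum>j<n. int (\<alpha> ! j))"
    by (intro sum.cong) auto
  also have "\<dots> = int (sum_list \<alpha>)"
    by (simp add: sum_list_sum_nth n_def lessThan_atLeast0)
  finally show ?thesis .
qed


section \<open>The dual Cauchy identity\<close>

text \<open>The resultant of the two alphabets.\<close>
definition cross_diff :: "nat \<Rightarrow> nat \<Rightarrow> mpoly" where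
  "cross_diff k l = (\<Prod>(i, j)\<in>{1..k} \<times> {k + 1..k + l}. Var i - Var j)"

definition dual_part :: "nat \<Rightarrow> nat list \<Rightarrow> nat list" where
  "dual_part l \<alpha> = conjugate l (complementary l \<alpha>)"

lemma length_dual_part [simp]: "length (dual_part l \<alpha>) = l"
  by (simp add: dual_part_def conjugate_def)

lemma vandermonde_split:
  "vandermonde 0 (k + l) = vandermonde 0 k * vandermonde k l * cross_diff k l"
proof -
  define f where "f = (\<lambda>(i, j). Var i - Var j)"
  define A where "A = {(i, j). 0 < i \<and> i < j \<and> j \<le> 0 + k}"
  define B where "B = {(i, j). k < i \<and> i < j \<and> j \<le> k + l}"
  define C where "C = {1..k} \<times> {k + 1..k + l}"
  have fin: "finite A" "finite B" "finite C"
    unfolding A_def B_def C_def by (rule finite_ordered_pairs finite_cartesian_product finite_atLeastAtMost)+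
  have disj: "A \<inter> B = {}" "(A \<union> B) \<inter> C = {}"
    unfolding A_def B_def C_def by force+
  have un: "{(i, j). 0 < i \<and> i < j \<and> j \<le> 0 + (k + l)} = A \<union> B \<union> C"
  proof (rule Set.set_eqI)
    fix x :: "nat \<times> nat"
    obtain i j where x: "x = (i, j)" by (cases x)
    show "x \<in> {(i, j). 0 < i \<and> i < j \<and> j \<le> 0 + (k + l)} \<longleftrightarrow> x \<in> A \<union> B \<union> C"
      unfolding A_def B_def C_def x by simp linarith
  qed
  have "prod f (A \<union> B \<union> C) = prod f (A \<union> B) * prod f C"
    using fin disj by (intro prod.union_disjoint) simp_all
  also have "prod f (A \<union> B) = prod f A * prod f B"
    using fin disj by (intro prod.union_disjoint)
  finally show ?thesis
    unfolding vandermonde_altdef cross_diff_def un f_def A_def B_def C_def .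
qed

text \<open>On its second block the shuffle of \<open>\<alpha>\<close> is given by counting the \<open>j\<close> with \<open>l - \<alpha>\<^sub>j \<le> m\<close>. This count
  turns the remaining columns of the Laplace expansion into the exponents of an alternant.\<close>
lemma dual_part_nth:
  assumes "\<alpha> \<in> box_partitions k l" "m < l"
  shows "dual_part l \<alpha> ! m + card {j. j < k \<and> l - \<alpha> ! j \<le> m} = k"
proof -
  have len: "length \<alpha> = k" using assms by (simp add: box_partitions_def)
  define P where "P = {j. j < k \<and> l - \<alpha> ! j \<le> m}"
  have P: "P \<subseteq> {..<k}" by (auto simp: P_def)
  have "dual_part l \<alpha> ! m = card {i. i < k \<and> Suc m \<le> complementary l \<alpha> ! i}"
    using assms len by (simp add: dual_part_def conjugate_def complementary_def del: upt_Suc)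
  also have "\<dots> = card {j. j < k \<and> \<not> l - \<alpha> ! j \<le> m}"
    by (rule bij_betw_same_card[of "\<lambda>i. k - Suc i"], rule bij_betw_byWitness[of _ "\<lambda>i. k - Suc i"])
       (auto simp: complementary_def rev_nth len)
  also have "{j. j < k \<and> \<not> l - \<alpha> ! j \<le> m} = {..<k} - P"
    unfolding P_def by blast
  also have "card \<dots> = k - card P"
    using P by (subst card_Diff_subset) (auto intro: finite_subset)
  finally show ?thesis
    using card_mono[OF finite_lessThan P] by (simp add: P_def)
qed

lemma sum_complement:
  assumes "\<alpha> \<in> box_partitions k l"
  shows "(\<Sum>i<k. l - \<alpha> ! i) + sum_list \<alpha> = k * l"
proof -
  have "length \<alpha> = k" using assms by (simp add: box_partitions_def)
  then have "(\<Sum>i<k. l - \<alpha> ! i) + sum_list \<alpha> = (\<Sum>i<k. l - \<alpha> ! i + \<alpha> ! i)"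
    by (simp add: sum_list_sum_nth lessThan_atLeast0 sum.distrib)
  also have "\<dots> = (\<Sum>i<k. l)"
    using box_partitions_nth_le[OF assms] by (intro sum.cong) auto
  finally show ?thesis by simp
qed

text \<open>Expand the Vandermonde determinant of both alphabets along the rows of the first one. The
  complementary minors are the alternants of \<open>\<alpha>\<close> and of the conjugate of its complement, and the
  Vandermonde determinants of the single alphabets cancel.\<close>
lemma dual_cauchy:
  "(\<Sum>\<alpha>\<in>box_partitions k l. (- 1) ^ sum_list \<alpha> * (schur 0 \<alpha> * schur k (dual_part l \<alpha>)))
    = (- 1) ^ (k * l) * cross_diff k l"
proof -
  define A where "A = mat (k + l) (k + l) (\<lambda>(i, j). Var (0 + Suc i) ^ (k + l - Suc j))"
  define V where "V = vandermonde 0 k * vandermonde k l"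
  have minor1: "det (mat k k (\<lambda>(i, j). A $$ (i, box_shuffle k l \<alpha> j))) = schur 0 \<alpha> * vandermonde 0 k"
    if \<alpha>: "\<alpha> \<in> box_partitions k l" for \<alpha>
  proof -
    have len: "length \<alpha> = k" using \<alpha> by (simp add: box_partitions_def)
    have "A $$ (i, box_shuffle k l \<alpha> j) = Var (0 + Suc i) ^ (\<alpha> ! j + k - Suc j)" if "i < k" "j < k" for i j
      using that box_partitions_nth_le[OF \<alpha> that(2)]
      by (simp add: A_def box_shuffle_def shuffle_def add.commute)
    then have "mat k k (\<lambda>(i, j). A $$ (i, box_shuffle k l \<alpha> j))
        = mat k k (\<lambda>(i, j). Var (0 + Suc i) ^ (\<alpha> ! j + k - Suc j))"
      by (intro eq_matI) auto
    then show ?thesis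
      using schur_mult_vandermonde[of 0 \<alpha>] by (simp add: len alternant_def)
  qed
  have minor2: "det (mat l l (\<lambda>(i, j). A $$ (k + i, box_shuffle k l \<alpha> (k + j))))
      = schur k (dual_part l \<alpha>) * vandermonde k l"
    if \<alpha>: "\<alpha> \<in> box_partitions k l" for \<alpha>
  proof -
    have "A $$ (k + i, box_shuffle k l \<alpha> (k + j)) = Var (k + Suc i) ^ (dual_part l \<alpha> ! j + l - Suc j)"
      if "i < l" "j < l" for i j
    proof -
      define c where "c = card {m. m < k \<and> l - \<alpha> ! m \<le> j}"
      have c: "dual_part l \<alpha> ! j + c = k" unfolding c_def by (rule dual_part_nth[OF \<alpha> that(2)])
      have "box_shuffle k l \<alpha> (k + j) = j + c"
        using that by (simp add: box_shuffle_def shuffle_def c_def)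
      moreover have "k + l - Suc (j + c) = dual_part l \<alpha> ! j + l - Suc j" "j + c < k + l"
        using c that by auto
      ultimately show ?thesis using that by (simp add: A_def)
    qed
    then have "mat l l (\<lambda>(i, j). A $$ (k + i, box_shuffle k l \<alpha> (k + j)))
        = mat l l (\<lambda>(i, j). Var (k + Suc i) ^ (dual_part l \<alpha> ! j + l - Suc j))"
      by (intro eq_matI) auto
    then show ?thesis
      using schur_mult_vandermonde[of k "dual_part l \<alpha>"] by (simp add: alternant_def)
  qed
  have sign: "(- 1) ^ (\<Sum>i<k. l - \<alpha> ! i) = (- 1) ^ (k * l) * ((- 1) ^ sum_list \<alpha> :: mpoly)"
    if \<alpha>: "\<alpha> \<in> box_partitions k l" for \<alpha>
    unfolding sum_complement[OF \<alpha>, symmetric]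
    by (simp add: power_add mult.assoc flip: power_mult_distrib)
  have "V * cross_diff k l = vandermonde 0 (k + l)"
    by (simp only: V_def vandermonde_split)
  also have "\<dots> = det A"
    unfolding vandermonde_eq_alternant alternant_def A_def Let_def length_replicate
    by (intro arg_cong[where f = det] eq_matI) auto
  also have "\<dots> = (\<Sum>\<alpha>\<in>box_partitions k l. (- 1) ^ (\<Sum>i<k. l - \<alpha> ! i) *
    (det (mat k k (\<lambda>(i, j). A $$ (i, box_shuffle k l \<alpha> j))) *
     det (mat l l (\<lambda>(i, j). A $$ (k + i, box_shuffle k l \<alpha> (k + j))))))"
    by (rule laplace_expansion_blocks) (simp add: A_def)
  also have "\<dots> = (\<Sum>\<alpha>\<in>box_partitions k l. V * ((- 1) ^ (k * l) *
      ((- 1) ^ sum_list \<alpha> * (schur 0 \<alpha> * schur k (dual_part l \<alpha>)))))"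
  proof (intro sum.cong refl)
    fix \<alpha> assume \<alpha>: "\<alpha> \<in> box_partitions k l"
    show "(- 1) ^ (\<Sum>i<k. l - \<alpha> ! i) *
      (det (mat k k (\<lambda>(i, j). A $$ (i, box_shuffle k l \<alpha> j))) *
       det (mat l l (\<lambda>(i, j). A $$ (k + i, box_shuffle k l \<alpha> (k + j))))) =
      V * ((- 1) ^ (k * l) * ((- 1) ^ sum_list \<alpha> * (schur 0 \<alpha> * schur k (dual_part l \<alpha>))))"
      unfolding minor1[OF \<alpha>] minor2[OF \<alpha>] sign[OF \<alpha>] V_def by (simp only: ac_simps)
  qed
  also have "\<dots> = V * ((- 1) ^ (k * l) *
      (\<Sum>\<alpha>\<in>box_partitions k l. (- 1) ^ sum_list \<alpha> * (schur 0 \<alpha> * schur k (dual_part l \<alpha>))))"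
    by (simp only: sum_distrib_left)
  finally have "cross_diff k l = (- 1) ^ (k * l) *
      (\<Sum>\<alpha>\<in>box_partitions k l. (- 1) ^ sum_list \<alpha> * (schur 0 \<alpha> * schur k (dual_part l \<alpha>)))"
    by (simp add: V_def vandermonde_nonzero)
  then show ?thesis by (simp add: mult.assoc[symmetric] flip: power_mult_distrib)
qed


section \<open>Block-symmetric polynomials\<close>

definition block_perm :: "nat \<Rightarrow> nat \<Rightarrow> (nat \<Rightarrow> nat) \<Rightarrow> bool" where
  "block_perm k l w \<longleftrightarrow> w permutes {1..k + l} \<and> w ` {1..k} = {1..k}"

lemma block_permE:
  assumes "block_perm k l w"
  obtains \<sigma> \<tau> where "\<sigma> permutes {1..k}" "\<tau> permutes {k + 1..k + l}" "w = \<sigma> \<circ> \<tau>"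
proof
  define \<sigma> where "\<sigma> i = (if i \<in> {1..k} then w i else i)" for i
  define \<tau> where "\<tau> i = (if i \<in> {k + 1..k + l} then w i else i)" for i
  have w: "w permutes {1..k + l}" "w ` {1..k} = {1..k}" using assms by (auto simp: block_perm_def)
  have inj: "inj w" using w(1) by (rule permutes_inj)
  have upper: "{k + 1..k + l} = {1..k + l} - {1..k}" by auto
  have w_upper: "w ` {k + 1..k + l} = {k + 1..k + l}"
    unfolding upper by (simp only: image_set_diff[OF inj] w(2) permutes_image[OF w(1)])
  show "\<sigma> permutes {1..k}"
  proof (rule bij_imp_permutes)
    have "bij_betw w {1..k} {1..k}" using inj_on_subset[OF inj subset_UNIV] w(2) by (simp add: bij_betw_def)
    then show "bij_betw \<sigma> {1..k} {1..k}" by (subst bij_betw_cong[of _ _ w]) (auto simp: \<sigma>_def)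
  qed (auto simp: \<sigma>_def)
  show "\<tau> permutes {k + 1..k + l}"
  proof (rule bij_imp_permutes)
    have "bij_betw w {k + 1..k + l} {k + 1..k + l}"
      using inj_on_subset[OF inj subset_UNIV] w_upper by (simp add: bij_betw_def)
    then show "bij_betw \<tau> {k + 1..k + l} {k + 1..k + l}"
      by (subst bij_betw_cong[of _ _ w]) (auto simp: \<tau>_def)
  qed (auto simp: \<tau>_def)
  show "w = \<sigma> \<circ> \<tau>"
  proof
    fix i
    show "w i = (\<sigma> \<circ> \<tau>) i"
    proof (cases "i \<in> {k + 1..k + l}")
      case True
      then have "w i \<in> {k + 1..k + l}" using w_upper by blast
      then show ?thesis using True by (simp add: \<sigma>_def \<tau>_def)
    next
      case False
      then show ?thesis using permutes_not_in[OF w(1), of i] by (auto simp: \<sigma>_def \<tau>_def)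
    qed
  qed
qed

lemma block_comp_right:
  fixes k l :: nat
  assumes "\<sigma> permutes {1..k}" "\<tau> permutes {k + 1..k + l}" "i \<in> {k + 1..k + l}"
  shows "(\<sigma> \<circ> \<tau>) i = \<tau> i"
proof -
  have "\<tau> i \<in> {k + 1..k + l}" using assms(2,3) by (simp only: permutes_in_image)
  then have "\<tau> i \<notin> {1..k}" by auto
  then show ?thesis using permutes_not_in[OF assms(1)] by simp
qed

lemma block_permI:
  assumes \<sigma>: "\<sigma> permutes {1..k}" and \<tau>: "\<tau> permutes {k + 1..k + l}"
  shows "block_perm k l (\<sigma> \<circ> \<tau>)"
proof -
  have "\<sigma> permutes {1..k + l}" "\<tau> permutes {1..k + l}"
    using \<sigma> \<tau> by (auto intro: permutes_subset)
  moreover have "(\<sigma> \<circ> \<tau>) ` {1..k} = \<sigma> ` {1..k}"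
    using permutes_not_in[OF \<tau>] by (intro image_cong) auto
  ultimately show ?thesis
    using permutes_image[OF \<sigma>] by (auto simp: block_perm_def intro: permutes_compose)
qed

lemma R_sym_iff:
  "p \<in> R_sym n \<longleftrightarrow> p \<in> polys_in {1..n} \<and> (\<forall>\<sigma>. \<sigma> permutes {1..n} \<longrightarrow> rename \<sigma> p = p)"
  by (auto simp: R_sym_def perm_act_eq_rename permutes_bij)

lemma R_pair_iff:
  "p \<in> R_pair k l \<longleftrightarrow> p \<in> polys_in {1..k + l} \<and> (\<forall>w. block_perm k l w \<longrightarrow> rename w p = p)"
proof -
  have "perm_act (\<sigma> \<circ> \<tau>) p = rename (\<sigma> \<circ> \<tau>) p"
    if "\<sigma> permutes {1..k}" "\<tau> permutes {k + 1..k + l}" for \<sigma> \<tau>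
    by (rule perm_act_eq_rename) (use that in \<open>auto intro: permutes_bij bij_comp\<close>)
  then show ?thesis unfolding R_pair_def using block_permI block_permE by (smt (verit) mem_Collect_eq)
qed

lemma R_sym_subset_R_pair: "R_sym (k + l) \<subseteq> R_pair k l"
  by (auto simp: R_sym_iff R_pair_iff block_perm_def)

lemma R_pair_closed:
  shows "0 \<in> R_pair k l" "1 \<in> R_pair k l" "Const c \<in> R_pair k l"
    "p \<in> R_pair k l \<Longrightarrow> q \<in> R_pair k l \<Longrightarrow> p + q \<in> R_pair k l"
    "p \<in> R_pair k l \<Longrightarrow> - p \<in> R_pair k l"
    "p \<in> R_pair k l \<Longrightarrow> q \<in> R_pair k l \<Longrightarrow> p * q \<in> R_pair k l"
  by (auto simp: R_pair_iff rename_add rename_uminus rename_mult polys_in_closed)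

lemma sum_Var_in_R_pair: "(\<Sum>i\<in>{1..k}. Var i) \<in> R_pair k l"
proof -
  have "(\<Sum>i\<in>{1..k}. Var (w i)) = (\<Sum>i\<in>{1..k}. Var i)" if "block_perm k l w" for w
  proof -
    have "inj_on w {1..k}" "w ` {1..k} = {1..k}"
      using that permutes_inj_on by (auto simp: block_perm_def)
    then show ?thesis by (metis (no_types, lifting) sum.reindex_cong)
  qed
  then show ?thesis
    by (auto simp: R_pair_iff rename_sum intro!: polys_in_closed Var_in_polys_in)
qed

text \<open>So a single element of \<open>R_pair k l\<close> tells block permutations from all other ones.\<close>
lemma sum_Var_moved:
  assumes w: "w permutes {1..k + l}" "\<not> block_perm k l w"
  shows "rename w (\<Sum>i\<in>{1..k}. Var i) \<noteq> (\<Sum>i\<in>{1..k}. Var i)"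
proof
  assume eq: "rename w (\<Sum>i\<in>{1..k}. Var i) = (\<Sum>i\<in>{1..k}. Var i)"
  have inj: "inj_on w {1..k}" using w(1) by (rule permutes_inj_on)
  have lookup_sum_Var: "Poly_Mapping.lookup (\<Sum>i\<in>A. Var i) (Poly_Mapping.single j 1) = (if j \<in> A then 1 else 0)"
    if "finite A" for A j
  proof -
    have "Poly_Mapping.single i (1::nat) = Poly_Mapping.single j 1 \<longleftrightarrow> i = j" for i
      by (metis keys_single singleton_inject zero_neq_one)
    then show ?thesis using that by (simp add: lookup_sum Var_def lookup_single when_def)
  qed
  have "rename w (\<Sum>i\<in>{1..k}. Var i) = (\<Sum>i\<in>w ` {1..k}. Var i)"
    by (simp only: rename_sum sum.reindex[OF inj] o_def rename_Var)
  with eq have eq': "(\<Sum>i\<in>w ` {1..k}. Var i) = (\<Sum>i\<in>{1..k}. Var i)" by simp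
  have "j \<in> w ` {1..k} \<longleftrightarrow> j \<in> {1..k}" for j
    using arg_cong[OF eq', of "\<lambda>p. Poly_Mapping.lookup p (Poly_Mapping.single j 1)"]
      lookup_sum_Var[of "w ` {1..k}" j] lookup_sum_Var[of "{1..k}" j]
    by (simp split: if_splits)
  then have "w ` {1..k} = {1..k}" by blast
  then show False using w by (simp add: block_perm_def)
qed

lemma schur_left_in_R_pair:
  assumes "length \<alpha> = k"
  shows "schur 0 \<alpha> \<in> R_pair k l"
proof -
  have polys: "schur 0 \<alpha> \<in> polys_in {1..k}" using schur_in_polys_in[of 0 \<alpha>] assms by simp
  have "rename w (schur 0 \<alpha>) = schur 0 \<alpha>" if w: "block_perm k l w" for w
  proof -
    obtain \<sigma> \<tau> where \<sigma>\<tau>: "\<sigma> permutes {1..k}" "\<tau> permutes {k + 1..k + l}" "w = \<sigma> \<circ> \<tau>"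
      using w by (rule block_permE)
    have "rename w (schur 0 \<alpha>) = rename \<sigma> (schur 0 \<alpha>)"
      by (rule rename_cong[OF polys]) (use permutes_not_in[OF \<sigma>\<tau>(2)] in \<open>auto simp: \<sigma>\<tau>(3)\<close>)
    then show ?thesis using rename_schur[of \<sigma> 0 \<alpha>] \<sigma>\<tau>(1) assms by simp
  qed
  then show ?thesis using polys_in_mono[OF polys] by (auto simp: R_pair_iff)
qed

lemma schur_right_in_R_pair:
  assumes "length \<beta> = l"
  shows "schur k \<beta> \<in> R_pair k l"
proof -
  have polys: "schur k \<beta> \<in> polys_in {k + 1..k + l}" using schur_in_polys_in[of k \<beta>] assms by simp
  have "rename w (schur k \<beta>) = schur k \<beta>" if w: "block_perm k l w" for w
  proof -
    obtain \<sigma> \<tau> where \<sigma>\<tau>: "\<sigma> permutes {1..k}" "\<tau> permutes {k + 1..k + l}" "w = \<sigma> \<circ> \<tau>"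
      using w by (rule block_permE)
    have "rename w (schur k \<beta>) = rename \<tau> (schur k \<beta>)"
      unfolding \<sigma>\<tau>(3) by (rule rename_cong[OF polys block_comp_right[OF \<sigma>\<tau>(1,2)]])
    then show ?thesis using rename_schur[of \<tau> k \<beta>] \<sigma>\<tau>(2) assms by simp
  qed
  then show ?thesis using polys_in_mono[OF polys] by (auto simp: R_pair_iff)
qed


section \<open>Dual bases for the symmetrising trace\<close>

definition antisymmetrize :: "nat \<Rightarrow> mpoly \<Rightarrow> mpoly" where
  "antisymmetrize n g = (\<Sum>w | w permutes {1..n}. signof w * rename w g)"

lemma rename_antisymmetrize:
  assumes u: "u permutes {1..n}"
  shows "rename u (antisymmetrize n g) = signof u * antisymmetrize n g"
proof -
  have "signof u * antisymmetrize n g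
      = (\<Sum>w | w permutes {1..n}. signof u * (signof (u \<circ> w) * rename (u \<circ> w) g))"
    unfolding antisymmetrize_def sum_distrib_left
    by (rule setum_permutations_compose_left[OF u])
  also have "\<dots> = (\<Sum>w | w permutes {1..n}. signof w * rename (u \<circ> w) g)"
  proof (intro sum.cong refl)
    fix w assume "w \<in> {w. w permutes {1..n}}"
    then have "sign (u \<circ> w) = sign u * sign w"
      using u by (intro sign_compose) (auto intro: permutes_imp_permutation[of "{1..n}"])
    then show "signof u * (signof (u \<circ> w) * rename (u \<circ> w) g) = signof w * rename (u \<circ> w) g"
      by (cases u rule: sign_cases) (simp_all only: of_int_mult, simp_all)
  qed
  also have "\<dots> = rename u (antisymmetrize n g)"
    by (simp only: antisymmetrize_def rename_sum rename_mult rename_of_int rename_rename)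
  finally show ?thesis by simp
qed

text \<open>An antisymmetric polynomial vanishes when two of its variables are equated.\<close>
lemma vandermonde_dvd_antisymmetrize: "vandermonde 0 n dvd antisymmetrize n g"
proof (rule vandermonde_dvdI)
  fix i j assume ij: "0 < i" "i < j" "j \<le> 0 + n"
  define u where "u = Transposition.transpose i j"
  have u: "u permutes {1..n}" unfolding u_def using ij by (intro permutes_swap_id) auto
  have "id(j := i) \<circ> u = id(j := i)" by (auto simp: u_def fun_eq_iff transpose_def)
  then have "rename (id(j := i)) (antisymmetrize n g)
      = rename (id(j := i)) (rename u (antisymmetrize n g))"
    by (simp only: rename_rename)
  also have "rename u (antisymmetrize n g) = - antisymmetrize n g"
    using ij unfolding rename_antisymmetrize[OF u] by (simp add: u_def sign_swap_id)
  finally have "2 * rename (id(j := i)) (antisymmetrize n g) = 0"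
    by (simp only: rename_uminus eq_neg_iff_add_eq_0 mult_2)
  then show "rename (id(j := i)) (antisymmetrize n g) = 0"
    by (simp only: mult_eq_0_iff zero_neq_numeral[symmetric] simp_thms)
qed

text \<open>The sum of \<open>w (q / cross_diff k l)\<close> over all permutations \<open>w\<close>, which on \<open>R_pair k l\<close> is \<open>k! l!\<close> times
  the sum over cosets. Multiplying by the Vandermonde polynomial clears the denominators and
  turns it into an antisymmetrisation.\<close>
definition trace :: "nat \<Rightarrow> nat \<Rightarrow> mpoly \<Rightarrow> mpoly" where
  "trace k l q = (SOME d. d * vandermonde 0 (k + l)
     = antisymmetrize (k + l) (q * (vandermonde 0 k * vandermonde k l)))"

lemma trace_mult_vandermonde:
  "trace k l q * vandermonde 0 (k + l)
    = antisymmetrize (k + l) (q * (vandermonde 0 k * vandermonde k l))"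
proof -
  obtain d where "antisymmetrize (k + l) (q * (vandermonde 0 k * vandermonde k l))
      = vandermonde 0 (k + l) * d"
    using vandermonde_dvd_antisymmetrize by (rule dvdE)
  then have "d * vandermonde 0 (k + l)
      = antisymmetrize (k + l) (q * (vandermonde 0 k * vandermonde k l))"
    by (simp only: mult.commute)
  then show ?thesis unfolding trace_def by (rule someI)
qed

lemma trace_in_R_sym:
  assumes "q \<in> polys_in {1..k + l}"
  shows "trace k l q \<in> R_sym (k + l)"
  unfolding R_sym_iff
proof (intro conjI allI impI)
  have left: "vandermonde 0 k \<in> polys_in {1..k + l}"
    using polys_in_mono[OF vandermonde_in_polys_in[of 0 k], of "{1..k + l}"] by simp
  have right: "vandermonde k l \<in> polys_in {1..k + l}"
    using polys_in_mono[OF vandermonde_in_polys_in[of k l], of "{1..k + l}"] by simp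
  have "rename w (q * (vandermonde 0 k * vandermonde k l)) \<in> polys_in {1..k + l}"
    if "w permutes {1..k + l}" for w
    using permutes_image[OF that]
    by (intro rename_in_polys_in[of _ "{1..k + l}"] polys_in_closed assms left right) simp
  then have "antisymmetrize (k + l) (q * (vandermonde 0 k * vandermonde k l)) \<in> polys_in {1..k + l}"
    unfolding antisymmetrize_def
    by (intro polys_in_closed(7,9)) (auto simp: sign_def intro: polys_in_closed)
  then have "trace k l q * vandermonde 0 (k + l) \<in> polys_in {1..k + l}"
    by (simp only: trace_mult_vandermonde)
  moreover have "vandermonde 0 (k + l) \<in> polys_in {1..k + l}"
    using vandermonde_in_polys_in[of 0 "k + l"] by simp
  ultimately show "trace k l q \<in> polys_in {1..k + l}"
    by (rule polys_in_cofactor) (rule vandermonde_nonzero)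
next
  fix u assume u: "u permutes {1..k + l}"
  have "rename u (trace k l q) * (signof u * vandermonde 0 (k + l))
      = rename u (trace k l q * vandermonde 0 (k + l))"
    using u rename_vandermonde[of u 0 "k + l"] by (simp add: rename_mult)
  also have "\<dots> = signof u * (trace k l q * vandermonde 0 (k + l))"
    by (simp only: trace_mult_vandermonde rename_antisymmetrize[OF u])
  finally show "rename u (trace k l q) = trace k l q"
    using vandermonde_nonzero[of 0 "k + l"] by (cases u rule: sign_cases) auto
qed

lemma rename_block_perm_vandermonde:
  assumes "\<sigma> permutes {1..k}" "\<tau> permutes {k + 1..k + l}"
  shows "rename (\<sigma> \<circ> \<tau>) (vandermonde 0 k * vandermonde k l)
    = signof (\<sigma> \<circ> \<tau>) * (vandermonde 0 k * vandermonde k l)"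
proof -
  have "rename (\<sigma> \<circ> \<tau>) (vandermonde 0 k) = rename \<sigma> (vandermonde 0 k)"
    by (rule rename_cong[OF vandermonde_in_polys_in]) (use permutes_not_in[OF assms(2)] in auto)
  moreover have "rename (\<sigma> \<circ> \<tau>) (vandermonde k l) = rename \<tau> (vandermonde k l)"
    by (rule rename_cong[OF vandermonde_in_polys_in block_comp_right[OF assms]])
  moreover have "sign (\<sigma> \<circ> \<tau>) = sign \<sigma> * sign \<tau>"
    using assms by (intro sign_compose) (auto intro: permutes_imp_permutation[OF finite_atLeastAtMost])
  ultimately show ?thesis
    using rename_vandermonde[of \<sigma> 0 k] rename_vandermonde[of \<tau> k l] assms
    by (simp only: rename_mult of_int_mult add_0) (simp only: ac_simps)
qed

text \<open>Acting only on the first alphabet turns the product of the differences into one that contains a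
  zero factor as soon as the permutation mixes the blocks.\<close>
lemma dual_cauchy_rename:
  assumes w: "w permutes {1..k + l}"
  shows "(\<Sum>\<alpha>\<in>box_partitions k l. (- 1) ^ sum_list \<alpha> *
      (rename w (schur 0 \<alpha>) * schur k (dual_part l \<alpha>)))
    = (if block_perm k l w then (- 1) ^ (k * l) * cross_diff k l else 0)"
proof -
  \<comment> \<open>Not injective in general: this is where the identity is specialised to overlapping alphabets.\<close>
  define f where "f i = (if i \<in> {1..k} then w i else i)" for i
  have f_right: "rename f (schur k (dual_part l \<alpha>)) = schur k (dual_part l \<alpha>)" for \<alpha>
    using rename_cong[OF schur_in_polys_in, of k "dual_part l \<alpha>" f id]
    by (auto simp: f_def rename_id)
  have f_left: "rename f (schur 0 \<alpha>) = rename w (schur 0 \<alpha>)" if "\<alpha> \<in> box_partitions k l" for \<alpha>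
    by (rule rename_cong[OF schur_in_polys_in]) (use that in \<open>auto simp: f_def box_partitions_def\<close>)
  have f_cross: "rename f (cross_diff k l) = (\<Prod>i\<in>{1..k}. \<Prod>j\<in>{k + 1..k + l}. Var (w i) - Var j)"
    unfolding cross_diff_def rename_prod prod.cartesian_product
    by (intro prod.cong) (auto simp: f_def rename_diff)
  have neg1: "rename f ((- 1) ^ a) = (- 1) ^ a" for a by (simp add: rename_power rename_uminus)
  have "(\<Sum>\<alpha>\<in>box_partitions k l. (- 1) ^ sum_list \<alpha> *
      (rename w (schur 0 \<alpha>) * schur k (dual_part l \<alpha>)))
    = rename f (\<Sum>\<alpha>\<in>box_partitions k l. (- 1) ^ sum_list \<alpha> * (schur 0 \<alpha> * schur k (dual_part l \<alpha>)))"
    by (simp add: rename_sum rename_mult neg1 f_left f_right)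
  also have "\<dots> = (- 1) ^ (k * l) * rename f (cross_diff k l)"
    by (simp only: dual_cauchy rename_mult neg1)
  also have "rename f (cross_diff k l) = (if block_perm k l w then cross_diff k l else 0)"
  proof (cases "block_perm k l w")
    case True
    then have "bij_betw w {1..k} {1..k}"
      using permutes_inj_on[OF w] by (simp add: block_perm_def bij_betw_def)
    then have "(\<Prod>i\<in>{1..k}. \<Prod>j\<in>{k + 1..k + l}. Var (w i) - Var j)
        = (\<Prod>i\<in>{1..k}. \<Prod>j\<in>{k + 1..k + l}. Var i - Var j)"
      by (rule prod.reindex_bij_betw)
    also have "\<dots> = cross_diff k l" by (simp only: cross_diff_def prod.cartesian_product)
    finally show ?thesis using True by (simp only: f_cross if_True)
  next
    case False
    have "\<not> w ` {1..k} \<subseteq> {1..k}"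
    proof
      assume "w ` {1..k} \<subseteq> {1..k}"
      then have "w ` {1..k} = {1..k}"
        using permutes_inj_on[OF w] by (intro endo_inj_surj) auto
      then show False using False w by (simp add: block_perm_def)
    qed
    then obtain i where i: "i \<in> {1..k}" "w i \<notin> {1..k}" by blast
    then have "w i \<in> {k + 1..k + l}" using permutes_in_image[OF w, of i] by auto
    then have "(\<Prod>j\<in>{k + 1..k + l}. Var (w i) - Var j) = 0"
      by (intro prod_zero) auto
    then have "rename f (cross_diff k l) = 0"
      unfolding f_cross using i(1) by (intro prod_zero) auto
    then show ?thesis using False by simp
  qed
  finally show ?thesis by simp
qed

text \<open>After the sums are exchanged, the inner one is the dual Cauchy identity with the first alphabet
  renamed by \<open>w\<close>. Only block permutations survive, and each of them contributes \<open>(- 1) ^ (k * l) * q\<close>.\<close>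
lemma trace_dual_bases:
  assumes q: "q \<in> R_pair k l"
  shows "(\<Sum>\<alpha>\<in>box_partitions k l. (- 1) ^ sum_list \<alpha> *
      (trace k l (schur 0 \<alpha> * q) * schur k (dual_part l \<alpha>)))
    = (- 1) ^ (k * l) * of_nat (card {w. block_perm k l w}) * q"
proof -
  define V where "V = vandermonde 0 k * vandermonde k l"
  define N where "N = card {w. block_perm k l w}"
  have V: "vandermonde 0 (k + l) = V * cross_diff k l" by (simp add: V_def vandermonde_split)
  have "(\<Sum>\<alpha>\<in>box_partitions k l. (- 1) ^ sum_list \<alpha> *
      (trace k l (schur 0 \<alpha> * q) * schur k (dual_part l \<alpha>))) * vandermonde 0 (k + l)
    = (\<Sum>\<alpha>\<in>box_partitions k l. (- 1) ^ sum_list \<alpha> *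
      (antisymmetrize (k + l) (schur 0 \<alpha> * q * V) * schur k (dual_part l \<alpha>)))"
    unfolding sum_distrib_right V_def trace_mult_vandermonde[symmetric]
    by (intro sum.cong refl) (simp only: ac_simps)
  also have "\<dots> = (\<Sum>\<alpha>\<in>box_partitions k l. \<Sum>w | w permutes {1..k + l}.
      signof w * rename w (q * V) *
      ((- 1) ^ sum_list \<alpha> * (rename w (schur 0 \<alpha>) * schur k (dual_part l \<alpha>))))"
    unfolding antisymmetrize_def sum_distrib_left sum_distrib_right rename_mult
    by (intro sum.cong refl) (simp only: ac_simps)
  also have "\<dots> = (\<Sum>w | w permutes {1..k + l}. signof w * rename w (q * V) *
      (\<Sum>\<alpha>\<in>box_partitions k l.
        (- 1) ^ sum_list \<alpha> * (rename w (schur 0 \<alpha>) * schur k (dual_part l \<alpha>))))"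
    by (subst sum.swap) (simp only: sum_distrib_left)
  also have "\<dots> = (\<Sum>w | w permutes {1..k + l}.
      if block_perm k l w then (- 1) ^ (k * l) * q * vandermonde 0 (k + l) else 0)"
  proof (intro sum.cong refl)
    fix w assume "w \<in> {w. w permutes {1..k + l}}"
    then have w: "w permutes {1..k + l}" by simp
    show "signof w * rename w (q * V) * (\<Sum>\<alpha>\<in>box_partitions k l.
        (- 1) ^ sum_list \<alpha> * (rename w (schur 0 \<alpha>) * schur k (dual_part l \<alpha>)))
      = (if block_perm k l w then (- 1) ^ (k * l) * q * vandermonde 0 (k + l) else 0)"
    proof (cases "block_perm k l w")
      case True
      then obtain \<sigma> \<tau> where \<sigma>\<tau>: "\<sigma> permutes {1..k}" "\<tau> permutes {k + 1..k + l}" "w = \<sigma> \<circ> \<tau>"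
        by (rule block_permE)
      have "rename w (q * V) = q * (signof w * V)"
        using q True rename_block_perm_vandermonde[OF \<sigma>\<tau>(1,2)]
        by (simp only: rename_mult V_def \<sigma>\<tau>(3)[symmetric]) (simp add: R_pair_iff)
      then have "signof w * rename w (q * V) = q * V"
        by (cases w rule: sign_cases) simp_all
      then show ?thesis using True unfolding dual_cauchy_rename[OF w] V by (simp add: ac_simps)
    qed (simp add: dual_cauchy_rename[OF w])
  qed
  also have "\<dots> = (\<Sum>w | block_perm k l w. (- 1) ^ (k * l) * q * vandermonde 0 (k + l))"
    by (rule sum.mono_neutral_cong_right) (auto simp: block_perm_def finite_permutations)
  also have "\<dots> = (- 1) ^ (k * l) * of_nat N * q * vandermonde 0 (k + l)"
    by (simp add: N_def ac_simps)
  finally show ?thesis by (simp add: vandermonde_nonzero N_def)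
qed

definition dual_coeff :: "nat \<Rightarrow> nat \<Rightarrow> nat list \<Rightarrow> mpoly \<Rightarrow> mpoly" where
  "dual_coeff k l \<alpha> q =
     Const ((- 1) ^ (k * l + sum_list \<alpha>) / of_nat (card {w. block_perm k l w})) * trace k l (schur 0 \<alpha> * q)"

lemma dual_coeff_in_R_sym:
  assumes "q \<in> R_pair k l" "\<alpha> \<in> box_partitions k l"
  shows "dual_coeff k l \<alpha> q \<in> R_sym (k + l)"
proof -
  have "schur 0 \<alpha> * q \<in> polys_in {1..k + l}"
    using assms schur_left_in_R_pair[of \<alpha> k l] by (auto simp: R_pair_iff box_partitions_def polys_in_closed)
  from trace_in_R_sym[OF this] show ?thesis
    by (auto simp: dual_coeff_def R_sym_iff rename_mult polys_in_closed)
qed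

lemma dual_coeff_expansion:
  assumes q: "q \<in> R_pair k l"
  shows "(\<Sum>\<alpha>\<in>box_partitions k l. dual_coeff k l \<alpha> q * schur k (dual_part l \<alpha>)) = q"
proof -
  define N where "N = card {w. block_perm k l w}"
  have "finite {w. block_perm k l w}"
    by (rule finite_subset[of _ "{w. w permutes {1..k + l}}"]) (auto simp: block_perm_def finite_permutations)
  moreover have "id \<in> {w. block_perm k l w}" by (simp add: block_perm_def permutes_id)
  ultimately have N: "N > 0" unfolding N_def by (auto simp: card_gt_0_iff)
  have of_nat_Const: "(of_nat a :: mpoly) = Const (of_nat a)" for a
    by (induction a) (auto simp: Const_add)
  have neg1_Const: "((- 1) ^ a :: mpoly) = Const ((- 1) ^ a)" for a
    by (induction a) (auto simp: Const_mult Const_uminus)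
  have "(\<Sum>\<alpha>\<in>box_partitions k l. dual_coeff k l \<alpha> q * schur k (dual_part l \<alpha>))
    = Const ((- 1) ^ (k * l) / of_nat N) * (\<Sum>\<alpha>\<in>box_partitions k l. (- 1) ^ sum_list \<alpha> *
      (trace k l (schur 0 \<alpha> * q) * schur k (dual_part l \<alpha>)))"
    unfolding sum_distrib_left dual_coeff_def N_def[symmetric]
    by (intro sum.cong refl) (simp add: neg1_Const power_add mult.assoc flip: Const_mult)
  also have "\<dots> = Const ((- 1) ^ (k * l) / of_nat N * (- 1) ^ (k * l) * of_nat N) * q"
    unfolding trace_dual_bases[OF q] N_def[symmetric]
    by (simp only: Const_mult neg1_Const of_nat_Const mult.assoc)
  also have "(- 1) ^ (k * l) / of_nat N * (- 1) ^ (k * l) * of_nat N = (1 :: complex)"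
    using N by (simp flip: power_mult_distrib)
  finally show ?thesis by simp
qed

text \<open>The factors \<open>X w\<close> do not depend on \<open>q\<close>, so the coordinates of a tensor can be computed from its
  evaluations at the permutations \<open>w\<close>.\<close>
lemma dual_coeff_conjugates:
  "\<exists>X. \<forall>q. dual_coeff k l \<alpha> q * vandermonde 0 (k + l)
     = (\<Sum>w | w permutes {1..k + l}. X w * rename w q)"
proof -
  define c where "c = Const ((- 1) ^ (k * l + sum_list \<alpha>) / of_nat (card {w. block_perm k l w}))"
  have "dual_coeff k l \<alpha> q * vandermonde 0 (k + l) = (\<Sum>w | w permutes {1..k + l}.
      (c * signof w * rename w (schur 0 \<alpha> * (vandermonde 0 k * vandermonde k l))) * rename w q)" for q
    unfolding dual_coeff_def c_def[symmetric] mult.assoc[of c] trace_mult_vandermonde antisymmetrize_def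
      sum_distrib_left rename_mult
    by (intro sum.cong refl) (simp only: ac_simps)
  then show ?thesis by (intro exI allI)
qed


section \<open>The tensor square of a ring of polynomials over a subring\<close>

text \<open>The analogue of \<open>frag_extend\<close> with values in the polynomial ring.\<close>
definition lin :: "('z \<Rightarrow> mpoly) \<Rightarrow> ('z \<Rightarrow>\<^sub>0 int) \<Rightarrow> mpoly" where
  "lin \<phi> c = (\<Sum>z\<in>Poly_Mapping.keys c. of_int (Poly_Mapping.lookup c z) * \<phi> z)"

lemma lin_0 [simp]: "lin \<phi> 0 = 0"
  by (simp add: lin_def)

lemma lin_frag_of [simp]: "lin \<phi> (frag_of z) = \<phi> z"
  by (simp add: lin_def)

lemma lin_add: "lin \<phi> (c + d) = lin \<phi> c + lin \<phi> d"
  unfolding lin_def by (rule setsum_keys_plus_distrib) (auto simp: distrib_right)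

lemma lin_uminus: "lin \<phi> (- c) = - lin \<phi> c"
  using lin_add[of \<phi> c "- c"] by (simp add: eq_neg_iff_add_eq_0 add.commute)

lemma lin_diff: "lin \<phi> (c - d) = lin \<phi> c - lin \<phi> d"
  using lin_add[of \<phi> c "- d"] by (simp add: lin_uminus)

lemma lin_sum: "lin \<phi> (\<Sum>x\<in>A. c x) = (\<Sum>x\<in>A. lin \<phi> (c x))"
  by (induction A rule: infinite_finite_induct) (auto simp: lin_add)

lemma lin_cong: "(\<And>z. z \<in> Poly_Mapping.keys c \<Longrightarrow> \<phi> z = \<psi> z) \<Longrightarrow> lin \<phi> c = lin \<psi> c"
  by (simp add: lin_def)

lemma lin_combination:
  "lin (\<lambda>z. \<Sum>w\<in>W. X w * \<phi> w z) c = (\<Sum>w\<in>W. X w * lin (\<phi> w) c)"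
  unfolding lin_def sum_distrib_left by (subst sum.swap) (simp only: ac_simps)

lemma lin_mult_right: "lin (\<lambda>z. \<phi> z * p) c = lin \<phi> c * p"
  by (simp add: lin_def sum_distrib_right mult.assoc)

lemma rename_lin: "rename f (lin \<phi> c) = lin (\<lambda>z. rename f (\<phi> z)) c"
  by (simp add: lin_def rename_sum rename_mult rename_of_int)

text \<open>Computations in the tensor product take place on formal sums of pairs, modulo the subgroup \<open>K\<close>
  generated by the relators.\<close>
locale subring_pair =
  fixes R S :: "mpoly set"
  assumes S_subset: "S \<subseteq> R"
    and zero_closed: "0 \<in> R" and one_closed: "1 \<in> R"
    and add_closed: "\<And>x y. x \<in> R \<Longrightarrow> y \<in> R \<Longrightarrow> x + y \<in> R"
    and uminus_closed: "\<And>x. x \<in> R \<Longrightarrow> - x \<in> R"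
    and mult_closed: "\<And>x y. x \<in> R \<Longrightarrow> y \<in> R \<Longrightarrow> x * y \<in> R"
begin

abbreviation M :: "(mpoly, mpoly) graded_bimodule" where
  "M \<equiv> regular_bimodule R"

abbreviation T :: "(mpoly, (mpoly \<times> mpoly \<Rightarrow>\<^sub>0 int) set) graded_bimodule" where
  "T \<equiv> tensor_product S M M"

abbreviation F :: "(mpoly \<times> mpoly \<Rightarrow>\<^sub>0 int) monoid" where
  "F \<equiv> tensor_free M M"

abbreviation K :: "(mpoly \<times> mpoly \<Rightarrow>\<^sub>0 int) set" where
  "K \<equiv> tensor_kernel S M M"

abbreviation cls :: "(mpoly \<times> mpoly \<Rightarrow>\<^sub>0 int) \<Rightarrow> (mpoly \<times> mpoly \<Rightarrow>\<^sub>0 int) set" where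
  "cls \<equiv> tensor_class S M M"

definition lmul :: "mpoly \<Rightarrow> (mpoly \<times> mpoly \<Rightarrow>\<^sub>0 int) \<Rightarrow> (mpoly \<times> mpoly \<Rightarrow>\<^sub>0 int)" where
  "lmul r = frag_extend (\<lambda>(x, y). frag_of (r * x, y))"

definition rmul :: "mpoly \<Rightarrow> (mpoly \<times> mpoly \<Rightarrow>\<^sub>0 int) \<Rightarrow> (mpoly \<times> mpoly \<Rightarrow>\<^sub>0 int)" where
  "rmul r = frag_extend (\<lambda>(x, y). frag_of (x, y * r))"

lemma diff_closed: "x \<in> R \<Longrightarrow> y \<in> R \<Longrightarrow> x - y \<in> R"
  using add_closed[of x "- y"] uminus_closed by simp

lemma sum_closed: "(\<And>x. x \<in> A \<Longrightarrow> g x \<in> R) \<Longrightarrow> (\<Sum>x\<in>A. g x) \<in> R"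
  by (induction A rule: infinite_finite_induct) (auto intro: zero_closed add_closed)

lemma of_int_closed: "of_int a \<in> R"
proof -
  have "of_nat a \<in> R" for a by (induction a) (auto intro: zero_closed one_closed add_closed)
  moreover have "(of_int a :: mpoly) = (if 0 \<le> a then of_nat (nat a) else - of_nat (nat (- a)))"
    by simp
  ultimately show ?thesis using uminus_closed by (simp only: split: if_split) blast
qed

lemma lin_closed:
  assumes "Poly_Mapping.keys c \<subseteq> R \<times> R" "\<And>x y. x \<in> R \<Longrightarrow> y \<in> R \<Longrightarrow> \<phi> (x, y) \<in> R"
  shows "lin \<phi> c \<in> R"
  unfolding lin_def using assms by (intro sum_closed mult_closed of_int_closed) auto

lemma F_eq: "F = free_Abelian_group (R \<times> R)"
  by (simp add: tensor_free_def regular_bimodule_def)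

lemma group_F: "group F" and comm_group_F: "comm_group F"
  by (simp_all add: F_eq abelian_free_Abelian_group)

lemma relators_eq:
  "tensor_relators S M M =
     {frag_of (x + x', y) - frag_of (x, y) - frag_of (x', y) | x x' y. x \<in> R \<and> x' \<in> R \<and> y \<in> R} \<union>
     {frag_of (x, y + y') - frag_of (x, y) - frag_of (x, y') | x y y'. x \<in> R \<and> y \<in> R \<and> y' \<in> R} \<union>
     {frag_of (x * s, y) - frag_of (x, s * y) | x s y. x \<in> R \<and> s \<in> S \<and> y \<in> R}"
  by (simp add: tensor_relators_def regular_bimodule_def)

lemma keys_diff_subset:
  "Poly_Mapping.keys a \<subseteq> A \<Longrightarrow> Poly_Mapping.keys b \<subseteq> A \<Longrightarrow> Poly_Mapping.keys (a - b) \<subseteq> A"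
  using keys_diff[of a b] by blast

lemma keys_add_subset:
  "Poly_Mapping.keys a \<subseteq> A \<Longrightarrow> Poly_Mapping.keys b \<subseteq> A \<Longrightarrow> Poly_Mapping.keys (a + b) \<subseteq> A"
  using keys_add[of a b] by blast

lemma keys_sum_subset:
  "(\<And>i. i \<in> I \<Longrightarrow> Poly_Mapping.keys (b i) \<subseteq> A) \<Longrightarrow> Poly_Mapping.keys (sum b I) \<subseteq> A"
  using keys_sum[of b I] by blast

lemma relators_in_F: "tensor_relators S M M \<subseteq> carrier F"
proof
  fix c assume "c \<in> tensor_relators S M M"
  then show "c \<in> carrier F"
    unfolding relators_eq F_eq carrier_free_Abelian_group_iff
    by (elim UnE CollectE exE conjE; hypsubst; intro keys_diff_subset)
       (use S_subset in \<open>auto simp: keys_frag_of intro: add_closed mult_closed\<close>)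
qed

lemma subgroup_K: "subgroup K F"
  unfolding tensor_kernel_def by (rule group.generate_is_subgroup[OF group_F relators_in_F])

lemma K_subset: "c \<in> K \<Longrightarrow> Poly_Mapping.keys c \<subseteq> R \<times> R"
  using subsetD[OF subgroup.subset[OF subgroup_K], of c] by (simp add: F_eq)

lemma K_0: "0 \<in> K"
  using subgroup.one_closed[OF subgroup_K] by (simp add: F_eq)

lemma K_add: "a \<in> K \<Longrightarrow> b \<in> K \<Longrightarrow> a + b \<in> K"
  using subgroup.m_closed[OF subgroup_K] by (simp add: F_eq)

lemma K_uminus: "a \<in> K \<Longrightarrow> - a \<in> K"
  using subgroup.m_inv_closed[OF subgroup_K, of a] K_subset[of a] by (simp add: F_eq)

lemma K_diff: "a \<in> K \<Longrightarrow> b \<in> K \<Longrightarrow> a - b \<in> K"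
  using K_add[OF _ K_uminus, of a b] by simp

lemma K_sum: "(\<And>x. x \<in> A \<Longrightarrow> g x \<in> K) \<Longrightarrow> (\<Sum>x\<in>A. g x) \<in> K"
proof (induction A rule: infinite_finite_induct)
  case (insert x A)
  then show ?case using K_add[of "g x" "sum g A"] by simp
qed (simp_all add: K_0)

lemma K_add_left:
  "x \<in> R \<Longrightarrow> x' \<in> R \<Longrightarrow> y \<in> R \<Longrightarrow> frag_of (x + x', y) - frag_of (x, y) - frag_of (x', y) \<in> K"
  unfolding tensor_kernel_def by (rule generate.incl) (unfold relators_eq, blast)

lemma K_add_right:
  "x \<in> R \<Longrightarrow> y \<in> R \<Longrightarrow> y' \<in> R \<Longrightarrow> frag_of (x, y + y') - frag_of (x, y) - frag_of (x, y') \<in> K"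
  unfolding tensor_kernel_def by (rule generate.incl) (unfold relators_eq, blast)

lemma K_balanced:
  "x \<in> R \<Longrightarrow> s \<in> S \<Longrightarrow> y \<in> R \<Longrightarrow> frag_of (x * s, y) - frag_of (x, s * y) \<in> K"
  unfolding tensor_kernel_def by (rule generate.incl) (unfold relators_eq, blast)

lemma kernel_induct [consumes 1, case_names zero add_left add_right balanced add uminus]:
  assumes "c \<in> K" "P 0"
    and "\<And>x x' y. x \<in> R \<Longrightarrow> x' \<in> R \<Longrightarrow> y \<in> R \<Longrightarrow>
      P (frag_of (x + x', y) - frag_of (x, y) - frag_of (x', y))"
    and "\<And>x y y'. x \<in> R \<Longrightarrow> y \<in> R \<Longrightarrow> y' \<in> R \<Longrightarrow>
      P (frag_of (x, y + y') - frag_of (x, y) - frag_of (x, y'))"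
    and "\<And>x s y. x \<in> R \<Longrightarrow> s \<in> S \<Longrightarrow> y \<in> R \<Longrightarrow> P (frag_of (x * s, y) - frag_of (x, s * y))"
    and "\<And>a b. P a \<Longrightarrow> P b \<Longrightarrow> P (a + b)" "\<And>a. P a \<Longrightarrow> P (- a)"
  shows "P c"
proof -
  have rel: "P h" if "h \<in> tensor_relators S M M" for h
    using that assms(3-5) unfolding relators_eq by blast
  from assms(1) show ?thesis
    unfolding tensor_kernel_def
  proof (induction rule: generate.induct)
    case (inv h)
    then have "inv\<^bsub>F\<^esub> h = - h" using relators_in_F by (auto simp: F_eq)
    then show ?case using rel[OF inv] assms(7) by simp
  qed (use assms rel in \<open>auto simp: F_eq\<close>)
qed

lemma K_zero_left: "y \<in> R \<Longrightarrow> frag_of (0, y) \<in> K"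
  using K_uminus[OF K_add_left[OF zero_closed zero_closed, of y]] by simp

lemma K_sum_right:
  assumes "x \<in> R" "\<And>i. i \<in> A \<Longrightarrow> y i \<in> R"
  shows "frag_of (x, \<Sum>i\<in>A. y i) - (\<Sum>i\<in>A. frag_of (x, y i)) \<in> K"
  using assms(2)
proof (induction A rule: infinite_finite_induct)
  case (insert i A)
  have "(\<Sum>i\<in>A. y i) \<in> R" using insert by (intro sum_closed) auto
  from K_add[OF K_add_right[OF assms(1) _ this, of "y i"] insert.IH] insert
  show ?case by (simp add: algebra_simps)
qed (use K_uminus[OF K_add_right[OF assms(1) zero_closed zero_closed]] in auto)

lemma cls_eq: "cls c = {x. x - c \<in> K}"
proof -
  have "cls c = {k + c | k. k \<in> K}" by (auto simp: tensor_class_def r_coset_def F_eq)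
  also have "\<dots> = {x. x - c \<in> K}" by (auto intro: exI[of _ "_ - c"])
  finally show ?thesis .
qed

lemma cls_eq_iff: "cls c = cls d \<longleftrightarrow> c - d \<in> K"
proof
  assume "cls c = cls d"
  moreover have "c \<in> cls c" by (simp add: cls_eq K_0)
  ultimately show "c - d \<in> K" by (simp add: cls_eq)
next
  assume cd: "c - d \<in> K"
  have "x - c \<in> K \<longleftrightarrow> x - d \<in> K" for x
    using K_add[OF _ cd, of "x - c"] K_diff[OF _ cd, of "x - d"] by (auto simp: algebra_simps)
  then show "cls c = cls d" by (simp add: cls_eq)
qed

lemma carrier_T: "carrier T = cls ` {c. Poly_Mapping.keys c \<subseteq> R \<times> R}"
  by (auto simp: tensor_product_def Let_def FactGroup_def RCOSETS_def tensor_class_def F_eq)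

lemma cls_in_carrier: "Poly_Mapping.keys c \<subseteq> R \<times> R \<Longrightarrow> cls c \<in> carrier T"
  by (simp add: carrier_T)

lemma cls_0: "cls 0 = K"
  by (simp only: cls_eq diff_0_right Collect_mem_eq)

lemma set_mult_cls: "cls c <#>\<^bsub>F\<^esub> cls d = cls (c + d)"
proof -
  have "x \<in> (\<Union>a\<in>cls c. \<Union>b\<in>cls d. {a + b}) \<longleftrightarrow> x \<in> cls (c + d)" for x
  proof
    assume "x \<in> (\<Union>a\<in>cls c. \<Union>b\<in>cls d. {a + b})"
    then obtain a b where "x = a + b" "a - c \<in> K" "b - d \<in> K" by (auto simp: cls_eq)
    then show "x \<in> cls (c + d)" using K_add[of "a - c" "b - d"] by (simp add: cls_eq algebra_simps)
  next
    assume "x \<in> cls (c + d)"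
    then have "(x - d) - c \<in> K" by (simp add: cls_eq algebra_simps)
    then have "x - d \<in> cls c" "d \<in> cls d" by (simp_all add: cls_eq K_0)
    then show "x \<in> (\<Union>a\<in>cls c. \<Union>b\<in>cls d. {a + b})" by force
  qed
  then have "(\<Union>a\<in>cls c. \<Union>b\<in>cls d. {a + b}) = cls (c + d)" by (rule Set.set_eqI)
  moreover have "a \<otimes>\<^bsub>F\<^esub> b = a + b" for a b by (simp add: F_eq)
  ultimately show ?thesis by (simp only: set_mult_def)
qed

lemma zero_T: "\<zero>\<^bsub>T\<^esub> = cls 0"
  by (simp add: tensor_product_def Let_def cls_0)

lemma add_T: "cls c \<oplus>\<^bsub>T\<^esub> cls d = cls (c + d)"
  by (simp add: tensor_product_def Let_def set_mult_cls)

lemma group_Mod: "group (F Mod K)"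
  by (rule normal.factorgroup_is_group)
     (simp add: comm_group.normal_iff_subgroup[OF comm_group_F] subgroup_K)

lemma carrier_Mod: "carrier (F Mod K) = cls ` {c. Poly_Mapping.keys c \<subseteq> R \<times> R}"
  using carrier_T by (simp add: tensor_product_def Let_def)

lemma inv_Mod:
  assumes "Poly_Mapping.keys c \<subseteq> R \<times> R"
  shows "inv\<^bsub>F Mod K\<^esub> (cls c) = cls (- c)"
  by (rule group.inv_equality[OF group_Mod]) (use assms in \<open>auto simp: set_mult_cls cls_0 carrier_Mod\<close>)

lemma abelian_monoid_T: "abelian_monoid T"
proof (rule abelian_monoidI)
  fix X Y assume "X \<in> carrier T" "Y \<in> carrier T"
  then obtain a b where ab: "X = cls a" "Poly_Mapping.keys a \<subseteq> R \<times> R" "Y = cls b" "Poly_Mapping.keys b \<subseteq> R \<times> R"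
    unfolding carrier_T by blast
  show "X \<oplus>\<^bsub>T\<^esub> Y \<in> carrier T"
    unfolding ab(1,3) add_T by (rule cls_in_carrier[OF keys_add_subset[OF ab(2,4)]])
next
  show "\<zero>\<^bsub>T\<^esub> \<in> carrier T" unfolding zero_T by (rule cls_in_carrier) simp
qed (auto simp: carrier_T zero_T add_T ac_simps)

lemma finsum_T:
  assumes "finite A" "\<And>x. x \<in> A \<Longrightarrow> Poly_Mapping.keys (c x) \<subseteq> R \<times> R"
  shows "(\<Oplus>\<^bsub>T\<^esub>x\<in>A. cls (c x)) = cls (\<Sum>x\<in>A. c x)"
  using assms
proof (induction A)
  case empty
  then show ?case using abelian_monoid.finsum_empty[OF abelian_monoid_T] by (simp add: zero_T)
next
  case (insert x A)
  have "(\<Oplus>\<^bsub>T\<^esub>x\<in>insert x A. cls (c x)) = cls (c x) \<oplus>\<^bsub>T\<^esub> (\<Oplus>\<^bsub>T\<^esub>x\<in>A. cls (c x))"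
    using insert.prems insert.hyps
    by (intro abelian_monoid.finsum_insert[OF abelian_monoid_T]) (auto intro: cls_in_carrier)
  then show ?case using insert by (simp add: add_T)
qed

lemma lmul_simps [simp]:
  "lmul r 0 = 0" "lmul r (frag_of (x, y)) = frag_of (r * x, y)" "lmul r (- c) = - lmul r c"
  "lmul r (c + d) = lmul r c + lmul r d" "lmul r (c - d) = lmul r c - lmul r d"
  by (simp_all add: lmul_def frag_extend_minus frag_extend_add frag_extend_diff)

lemma rmul_simps [simp]:
  "rmul r 0 = 0" "rmul r (frag_of (x, y)) = frag_of (x, y * r)" "rmul r (- c) = - rmul r c"
  "rmul r (c + d) = rmul r c + rmul r d" "rmul r (c - d) = rmul r c - rmul r d"
  by (simp_all add: rmul_def frag_extend_minus frag_extend_add frag_extend_diff)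

lemma lmul_in_F:
  assumes "r \<in> R" "Poly_Mapping.keys c \<subseteq> R \<times> R"
  shows "Poly_Mapping.keys (lmul r c) \<subseteq> R \<times> R"
  using keys_frag_extend[of "\<lambda>(x, y). frag_of (r * x, y)" c] assms
  by (fastforce simp: lmul_def keys_frag_of intro: mult_closed)

lemma rmul_in_F:
  assumes "r \<in> R" "Poly_Mapping.keys c \<subseteq> R \<times> R"
  shows "Poly_Mapping.keys (rmul r c) \<subseteq> R \<times> R"
  using keys_frag_extend[of "\<lambda>(x, y). frag_of (x, y * r)" c] assms
  by (fastforce simp: rmul_def keys_frag_of intro: mult_closed)

lemma lmul_K:
  assumes "r \<in> R" "c \<in> K"
  shows "lmul r c \<in> K"
  using assms(2)
proof (induction rule: kernel_induct)
  case (add_left x x' y)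
  then show ?case
    using K_add_left[of "r * x" "r * x'" y] assms(1) by (simp add: distrib_left mult_closed)
next
  case (balanced x s y)
  then show ?case using K_balanced[of "r * x" s y] assms(1) by (simp add: mult_closed mult.assoc)
qed (use assms in \<open>auto intro: K_0 K_add K_uminus K_add_right mult_closed\<close>)

lemma rmul_K:
  assumes "r \<in> R" "c \<in> K"
  shows "rmul r c \<in> K"
  using assms(2)
proof (induction rule: kernel_induct)
  case (add_right x y y')
  then show ?case
    using K_add_right[of x "y * r" "y' * r"] assms(1) by (simp add: distrib_right mult_closed)
next
  case (balanced x s y)
  then show ?case using K_balanced[of x s "y * r"] assms(1) by (simp add: mult_closed mult.assoc)
qed (use assms in \<open>auto intro: K_0 K_add K_uminus K_add_left mult_closed\<close>)

lemma smult_T: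
  assumes "r \<in> R"
  shows "r \<odot>\<^bsub>T\<^esub> cls c = cls (lmul r c)"
proof -
  have "lmul r = frag_extend (\<lambda>(x, y). frag_of (r \<odot>\<^bsub>M\<^esub> x, y))"
    by (simp add: lmul_def regular_bimodule_def)
  then have "r \<odot>\<^bsub>T\<^esub> cls c = (\<Union>x\<in>cls c. cls (lmul r x))"
    by (simp only: tensor_product_def Let_def module.simps graded_bimodule.simps)
  also have "\<dots> = cls (lmul r c)"
  proof (rule UN_constant_eq)
    show "c \<in> cls c" by (simp add: cls_eq K_0)
    show "\<forall>x\<in>cls c. cls (lmul r x) = cls (lmul r c)"
    proof
      fix x assume "x \<in> cls c"
      then show "cls (lmul r x) = cls (lmul r c)"
        unfolding cls_eq_iff using lmul_K[OF assms, of "x - c"] by (simp add: cls_eq)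
    qed
  qed
  finally show ?thesis .
qed

lemma rsmult_T:
  assumes "r \<in> R"
  shows "rsmult T (cls c) r = cls (rmul r c)"
proof -
  have "rmul r = frag_extend (\<lambda>(x, y). frag_of (x, rsmult M y r))"
    by (simp add: rmul_def regular_bimodule_def)
  then have "rsmult T (cls c) r = (\<Union>x\<in>cls c. cls (rmul r x))"
    by (simp only: tensor_product_def Let_def module.simps graded_bimodule.simps)
  also have "\<dots> = cls (rmul r c)"
  proof (rule UN_constant_eq)
    show "c \<in> cls c" by (simp add: cls_eq K_0)
    show "\<forall>x\<in>cls c. cls (rmul r x) = cls (rmul r c)"
    proof
      fix x assume "x \<in> cls c"
      then show "cls (rmul r x) = cls (rmul r c)"
        unfolding cls_eq_iff using rmul_K[OF assms, of "x - c"] by (simp add: cls_eq)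
    qed
  qed
  finally show ?thesis .
qed

lemma lin_K:
  assumes "c \<in> K"
    and "\<And>x x' y. x \<in> R \<Longrightarrow> x' \<in> R \<Longrightarrow> y \<in> R \<Longrightarrow> \<phi> (x + x', y) = \<phi> (x, y) + \<phi> (x', y)"
    and "\<And>x y y'. x \<in> R \<Longrightarrow> y \<in> R \<Longrightarrow> y' \<in> R \<Longrightarrow> \<phi> (x, y + y') = \<phi> (x, y) + \<phi> (x, y')"
    and "\<And>x s y. x \<in> R \<Longrightarrow> s \<in> S \<Longrightarrow> y \<in> R \<Longrightarrow> \<phi> (x * s, y) = \<phi> (x, s * y)"
  shows "lin \<phi> c = 0"
  using assms(1) by (induction rule: kernel_induct) (auto simp: lin_add lin_uminus lin_diff assms(2-4))

lemma lin_lmul: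
  assumes "\<And>x y. \<phi> (r * x, y) = r * \<phi> (x, y)"
  shows "lin \<phi> (lmul r c) = r * lin \<phi> c"
proof -
  have "Poly_Mapping.keys c \<subseteq> UNIV" by simp
  then show ?thesis
    by (induction c rule: frag_induction) (auto simp: lin_diff assms right_diff_distrib)
qed

lemma lin_rmul:
  assumes "\<And>x y. \<phi> (x, y * r) = \<phi> (x, y) * s"
  shows "lin \<phi> (rmul r c) = lin \<phi> c * s"
proof -
  have "Poly_Mapping.keys c \<subseteq> UNIV" by simp
  then show ?thesis
    by (induction c rule: frag_induction) (auto simp: lin_diff assms left_diff_distrib)
qed

text \<open>A graded component is only known through generators, so homogeneity is carried along for a
  representative that is built from the generators.\<close>
lemma grade_T_homogeneous:
  assumes "X \<in> grade T d"
    and \<phi>: "\<And>x y i j. x \<in> R \<Longrightarrow> y \<in> R \<Longrightarrow> homogeneous i x \<Longrightarrow> homogeneous j y \<Longrightarrow> homogeneous (i + j) (\<phi> (x, y))"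
  shows "\<exists>c. Poly_Mapping.keys c \<subseteq> R \<times> R \<and> X = cls c \<and> homogeneous d (lin \<phi> c)"
proof -
  define gens where "gens = {pure_tensor S M M x y | x y. \<exists>i j. x \<in> grade M i \<and> y \<in> grade M j \<and> i + j = d}"
  have gen: "\<exists>c. Poly_Mapping.keys c \<subseteq> R \<times> R \<and> X = cls c \<and> homogeneous d (lin \<phi> c)" if X: "X \<in> gens" for X
  proof -
    obtain x y i j where xy: "X = pure_tensor S M M x y" "x \<in> grade M i" "y \<in> grade M j" "i + j = d"
      using X by (auto simp: gens_def)
    then show ?thesis using \<phi>[of x y i j]
      by (intro exI[of _ "frag_of (x, y)"]) (auto simp: pure_tensor_def regular_bimodule_def keys_frag_of)
  qed
  have "X \<in> generate (F Mod K) gens"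
    using assms(1) by (simp add: tensor_product_def Let_def gens_def)
  then show ?thesis
  proof (induction rule: generate.induct)
    case one
    then show ?case by (intro exI[of _ 0]) (auto simp: cls_0 homogeneous_iff_homog)
  next
    case (incl X)
    then show ?case by (rule gen)
  next
    case (inv X)
    from gen[OF inv] obtain c where c: "Poly_Mapping.keys c \<subseteq> R \<times> R" "X = cls c" "homogeneous d (lin \<phi> c)"
      by blast
    then show ?case
      by (intro exI[of _ "- c"]) (auto simp: inv_Mod lin_uminus homogeneous_iff_homog intro: homog_uminus)
  next
    case (eng X Y)
    then obtain a b where "Poly_Mapping.keys a \<subseteq> R \<times> R" "X = cls a" "homogeneous d (lin \<phi> a)"
      "Poly_Mapping.keys b \<subseteq> R \<times> R" "Y = cls b" "homogeneous d (lin \<phi> b)" by blast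
    then show ?case
      by (intro exI[of _ "a + b"])
         (auto simp: set_mult_cls lin_add homogeneous_iff_homog intro: homog_add dest: subsetD[OF keys_add])
  qed
qed

lemma sum_in_grade_T:
  assumes "finite A"
    and "\<And>\<alpha>. \<alpha> \<in> A \<Longrightarrow> x \<alpha> \<in> R \<and> y \<alpha> \<in> R \<and> (\<exists>i j. homogeneous i (x \<alpha>) \<and> homogeneous j (y \<alpha>) \<and> i + j = d)"
  shows "cls (\<Sum>\<alpha>\<in>A. frag_of (x \<alpha>, y \<alpha>)) \<in> grade T d"
proof -
  define gens where "gens = {pure_tensor S M M x y | x y. \<exists>i j. x \<in> grade M i \<and> y \<in> grade M j \<and> i + j = d}"
  have "cls (\<Sum>\<alpha>\<in>A. frag_of (x \<alpha>, y \<alpha>)) \<in> generate (F Mod K) gens"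
    using assms
  proof (induction A)
    case empty
    then show ?case using generate.one[of "F Mod K" gens] by (simp add: cls_0)
  next
    case (insert \<alpha> A)
    have "cls (frag_of (x \<alpha>, y \<alpha>)) \<in> gens"
      using insert.prems[of \<alpha>] by (auto simp: gens_def pure_tensor_def regular_bimodule_def)
    then have "cls (frag_of (x \<alpha>, y \<alpha>)) \<otimes>\<^bsub>F Mod K\<^esub> cls (\<Sum>\<alpha>\<in>A. frag_of (x \<alpha>, y \<alpha>)) \<in> generate (F Mod K) gens"
      by (intro generate.eng[OF generate.incl] insert.IH insert.prems) auto
    then show ?case using insert.hyps by (simp add: set_mult_cls)
  qed
  then show ?thesis by (simp add: tensor_product_def Let_def gens_def)
qed

text \<open>In \<open>x \<otimes> y = x \<otimes> \<Sum>\<^sub>\<alpha> s\<^sub>\<alpha>(y) b\<^sub>\<alpha>\<close> the coefficients belong to \<open>S\<close> and cross the tensor sign.\<close>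
lemma expansion_modulo_K:
  assumes fin: "finite A" and b: "\<And>\<alpha>. \<alpha> \<in> A \<Longrightarrow> b \<alpha> \<in> R"
    and s: "\<And>\<alpha> q. \<alpha> \<in> A \<Longrightarrow> q \<in> R \<Longrightarrow> s \<alpha> q \<in> S"
    and expand: "\<And>q. q \<in> R \<Longrightarrow> (\<Sum>\<alpha>\<in>A. s \<alpha> q * b \<alpha>) = q"
    and c: "Poly_Mapping.keys c \<subseteq> R \<times> R"
  shows "c - (\<Sum>\<alpha>\<in>A. frag_of (lin (\<lambda>(x, y). x * s \<alpha> y) c, b \<alpha>)) \<in> K"
  using c
proof (induction rule: free_Abelian_group_induct[consumes 1])
  case 1
  have "(\<Sum>\<alpha>\<in>A. frag_of (0, b \<alpha>)) \<in> K" using b by (intro K_sum K_zero_left)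
  then show ?case using K_uminus by simp
next
  case (2 c d)
  define E where "E \<alpha> = lin (\<lambda>(x, y). x * s \<alpha> y)" for \<alpha>
  have E: "E \<alpha> c \<in> R" "E \<alpha> d \<in> R" if "\<alpha> \<in> A" for \<alpha>
    unfolding E_def using 2 s[OF that] S_subset by (auto intro!: lin_closed mult_closed)
  have "(\<Sum>\<alpha>\<in>A. frag_of (E \<alpha> c - E \<alpha> d + E \<alpha> d, b \<alpha>) - frag_of (E \<alpha> c - E \<alpha> d, b \<alpha>) - frag_of (E \<alpha> d, b \<alpha>)) \<in> K"
    using E b by (intro K_sum K_add_left diff_closed)
  from K_add[OF K_diff[OF 2(3,4)] this] show ?case
    by (simp add: E_def lin_diff sum_subtractf sum.distrib algebra_simps)
next
  case (3 z)
  obtain x y where z: "z = (x, y)" "x \<in> R" "y \<in> R" using 3 by auto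
  have sb: "s \<alpha> y * b \<alpha> \<in> R" if "\<alpha> \<in> A" for \<alpha>
    using that s[OF that z(3)] S_subset b by (auto intro: mult_closed)
  have "frag_of (x, \<Sum>\<alpha>\<in>A. s \<alpha> y * b \<alpha>) - (\<Sum>\<alpha>\<in>A. frag_of (x, s \<alpha> y * b \<alpha>)) \<in> K"
    using z(2) sb by (rule K_sum_right)
  moreover have "(\<Sum>\<alpha>\<in>A. frag_of (x * s \<alpha> y, b \<alpha>) - frag_of (x, s \<alpha> y * b \<alpha>)) \<in> K"
    using z b s by (intro K_sum K_balanced)
  ultimately have "(frag_of (x, \<Sum>\<alpha>\<in>A. s \<alpha> y * b \<alpha>) - (\<Sum>\<alpha>\<in>A. frag_of (x, s \<alpha> y * b \<alpha>)))
      - (\<Sum>\<alpha>\<in>A. frag_of (x * s \<alpha> y, b \<alpha>) - frag_of (x, s \<alpha> y * b \<alpha>)) \<in> K"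
    by (rule K_diff)
  then show ?case using expand[OF z(3)] by (simp add: z(1) sum_subtractf)
qed

end


section \<open>Bimodule maps\<close>

text \<open>The evaluation \<open>x \<otimes> y \<mapsto> x \<cdot> w(y)\<close>, on formal sums.\<close>
definition conj_eval :: "(nat \<Rightarrow> nat) \<Rightarrow> (mpoly \<times> mpoly \<Rightarrow>\<^sub>0 int) \<Rightarrow> mpoly" where
  "conj_eval w = lin (\<lambda>(x, y). x * rename w y)"

lemma cross_diff_nonzero: "cross_diff k l \<noteq> 0"
proof -
  have "Var i - Var j \<noteq> 0" if "(i, j) \<in> {1..k} \<times> {k + 1..k + l}" for i j
    using that by auto
  then show ?thesis unfolding cross_diff_def by (subst prod_zero_iff) (auto split: prod.splits)
qed

lemma homog_cross_diff: "homog (\<lambda>_. 2) (2 * int k * int l) (cross_diff k l)"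
proof -
  have "homog (\<lambda>_. 2) (\<Sum>z\<in>{1..k} \<times> {k + 1..k + l}. 2) (cross_diff k l)"
    unfolding cross_diff_def
    by (rule homog_prod) (use homog_Var[of "\<lambda>_. 2"] in \<open>auto intro!: homog_diff\<close>)
  also have "(\<Sum>z\<in>{1..k} \<times> {k + 1..k + l}. 2) = 2 * int k * int l"
    by (simp add: card_cartesian_product)
  finally show ?thesis .
qed

lemma homog_neg1_power_mult: "homog \<mu> d p \<Longrightarrow> homog \<mu> d ((- 1) ^ a * p)"
  using homog_of_int_mult[of \<mu> d p "(- 1) ^ a"] by simp

lemma neg1_power_in_R_pair: "(- 1) ^ a \<in> R_pair k l"
  by (induction a) (auto intro: R_pair_closed)

locale bimodule_setup =
  fixes k l :: nat
begin

sublocale subring_pair "R_pair k l" "R_sym (k + l)"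
  by unfold_locales (use R_sym_subset_R_pair R_pair_closed in auto)

definition in_F :: "(mpoly \<times> mpoly \<Rightarrow>\<^sub>0 int) \<Rightarrow> bool" where
  "in_F c \<longleftrightarrow> Poly_Mapping.keys c \<subseteq> R_pair k l \<times> R_pair k l"

lemma conj_eval_K:
  assumes "w permutes {1..k + l}" "c \<in> K"
  shows "conj_eval w c = 0"
  unfolding conj_eval_def using assms(2)
proof (rule lin_K)
  fix x s y assume "s \<in> R_sym (k + l)"
  then have "rename w s = s" using assms(1) by (simp add: R_sym_iff)
  then show "(case (x * s, y) of (x, y) \<Rightarrow> x * rename w y) = (case (x, s * y) of (x, y) \<Rightarrow> x * rename w y)"
    by (simp add: rename_mult mult.assoc)
qed (simp_all add: rename_add distrib_left distrib_right)

text \<open>The coordinates of \<open>c\<close> in the basis formed by the Schur polynomials of the second alphabet are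
  combinations of the evaluations of \<open>c\<close>.\<close>
lemma conj_eval_injective:
  assumes c: "in_F c" and zero: "\<And>w. w permutes {1..k + l} \<Longrightarrow> conj_eval w c = 0"
  shows "c \<in> K"
proof -
  have coeff_zero: "lin (\<lambda>(x, y). x * dual_coeff k l \<alpha> y) c = 0" for \<alpha>
  proof -
    obtain X where X: "dual_coeff k l \<alpha> q * vandermonde 0 (k + l)
        = (\<Sum>w | w permutes {1..k + l}. X w * rename w q)" for q
      using dual_coeff_conjugates by blast
    have "lin (\<lambda>(x, y). x * dual_coeff k l \<alpha> y) c * vandermonde 0 (k + l)
      = lin (\<lambda>z. (case z of (x, y) \<Rightarrow> x * dual_coeff k l \<alpha> y) * vandermonde 0 (k + l)) c"
      by (rule lin_mult_right[symmetric])
    also have "\<dots> = lin (\<lambda>z. \<Sum>w | w permutes {1..k + l}. X w * (case z of (x, y) \<Rightarrow> x * rename w y)) c"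
    proof (rule lin_cong)
      fix z :: "mpoly \<times> mpoly"
      obtain x y where z: "z = (x, y)" by (cases z)
      have "x * dual_coeff k l \<alpha> y * vandermonde 0 (k + l)
          = (\<Sum>w | w permutes {1..k + l}. X w * (x * rename w y))"
        unfolding mult.assoc X sum_distrib_left by (intro sum.cong refl) (simp only: ac_simps)
      then show "(case z of (x, y) \<Rightarrow> x * dual_coeff k l \<alpha> y) * vandermonde 0 (k + l)
          = (\<Sum>w | w permutes {1..k + l}. X w * (case z of (x, y) \<Rightarrow> x * rename w y))"
        by (simp only: z case_prod_conv)
    qed
    also have "\<dots> = (\<Sum>w | w permutes {1..k + l}. X w * conj_eval w c)"
      unfolding conj_eval_def by (rule lin_combination)
    also have "\<dots> = 0" using zero by (intro sum.neutral) simp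
    finally show ?thesis using vandermonde_nonzero by simp
  qed
  have "c - (\<Sum>\<alpha>\<in>box_partitions k l.
      frag_of (lin (\<lambda>(x, y). x * dual_coeff k l \<alpha> y) c, schur k (dual_part l \<alpha>))) \<in> K"
    using c unfolding in_F_def
    by (intro expansion_modulo_K finite_box_partitions schur_right_in_R_pair length_dual_part
        dual_coeff_in_R_sym dual_coeff_expansion)
  moreover have "(\<Sum>\<alpha>\<in>box_partitions k l. frag_of (0, schur k (dual_part l \<alpha>))) \<in> K"
    by (intro K_sum K_zero_left schur_right_in_R_pair length_dual_part)
  ultimately show ?thesis
    unfolding coeff_zero using K_add by fastforce
qed

lemma cls_eqI:
  assumes "in_F c" "in_F d"
    and "\<And>w. w permutes {1..k + l} \<Longrightarrow> conj_eval w c = conj_eval w d"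
  shows "cls c = cls d"
  unfolding cls_eq_iff
proof (rule conj_eval_injective)
  show "in_F (c - d)" using assms(1,2) unfolding in_F_def by (rule keys_diff_subset)
  show "conj_eval w (c - d) = 0" if "w permutes {1..k + l}" for w
    using assms(3)[OF that] by (simp add: conj_eval_def lin_diff)
qed

lemma conj_eval_lmul: "conj_eval w (lmul r c) = r * conj_eval w c"
  unfolding conj_eval_def by (rule lin_lmul) (simp add: mult.assoc)

lemma conj_eval_rmul: "conj_eval w (rmul r c) = conj_eval w c * rename w r"
  unfolding conj_eval_def by (rule lin_rmul) (simp add: rename_mult mult.assoc)

lemma conj_eval_block_perm:
  assumes "in_F c" "block_perm k l w"
  shows "conj_eval w c = conj_eval id c"
  unfolding conj_eval_def
  by (rule lin_cong) (use assms in \<open>auto simp: in_F_def R_pair_iff rename_id\<close>)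

definition delta_rep :: "mpoly \<times> mpoly \<Rightarrow>\<^sub>0 int" where
  "delta_rep = (\<Sum>\<alpha>\<in>box_partitions k l.
     frag_of ((- 1) ^ sum_list \<alpha> * schur 0 \<alpha>, schur k (dual_part l \<alpha>)))"

lemma schur_pair_in_R:
  assumes "\<alpha> \<in> box_partitions k l" "x \<in> R_pair k l"
  shows "x * ((- 1) ^ sum_list \<alpha> * schur 0 \<alpha>) \<in> R_pair k l" "schur k (dual_part l \<alpha>) \<in> R_pair k l"
proof -
  have "length \<alpha> = k" using assms(1) by (simp add: box_partitions_def)
  then show "x * ((- 1) ^ sum_list \<alpha> * schur 0 \<alpha>) \<in> R_pair k l"
    by (intro mult_closed assms(2) neg1_power_in_R_pair schur_left_in_R_pair)
  show "schur k (dual_part l \<alpha>) \<in> R_pair k l"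
    by (intro schur_right_in_R_pair length_dual_part)
qed

lemma delta_rep_in_F: "in_F delta_rep"
  unfolding in_F_def delta_rep_def
proof (rule keys_sum_subset)
  fix \<alpha> assume "\<alpha> \<in> box_partitions k l"
  from schur_pair_in_R[OF this one_closed]
  show "Poly_Mapping.keys (frag_of ((- 1) ^ sum_list \<alpha> * schur 0 \<alpha>, schur k (dual_part l \<alpha>)))
      \<subseteq> R_pair k l \<times> R_pair k l"
    by (simp add: keys_frag_of)
qed

lemma Delta_one_eq: "Delta_one k l = cls delta_rep"
proof -
  have term_eq: "(- 1) ^ sum_list \<alpha> \<odot>\<^bsub>T\<^esub> pure_tensor (R_sym (k + l)) M M (schur 0 \<alpha>) (schur k (dual_part l \<alpha>))
      = cls (frag_of ((- 1) ^ sum_list \<alpha> * schur 0 \<alpha>, schur k (dual_part l \<alpha>)))" for \<alpha>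
    unfolding pure_tensor_def by (subst smult_T) (simp_all add: neg1_power_in_R_pair)
  have "(\<Oplus>\<^bsub>T\<^esub>\<alpha>\<in>box_partitions k l.
      cls (frag_of ((- 1) ^ sum_list \<alpha> * schur 0 \<alpha>, schur k (dual_part l \<alpha>)))) = cls delta_rep"
    unfolding delta_rep_def
  proof (rule finsum_T[OF finite_box_partitions])
    fix \<alpha> assume "\<alpha> \<in> box_partitions k l"
    from schur_pair_in_R[OF this one_closed]
    show "Poly_Mapping.keys (frag_of ((- 1) ^ sum_list \<alpha> * schur 0 \<alpha>, schur k (dual_part l \<alpha>)))
        \<subseteq> R_pair k l \<times> R_pair k l"
      by (simp add: keys_frag_of)
  qed
  then show ?thesis
    unfolding Delta_one_def dual_part_def[symmetric] term_eq .
qed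

lemma Delta_eq: "p \<in> R_pair k l \<Longrightarrow> Delta k l p = cls (lmul p delta_rep)"
  by (simp only: Delta_def Delta_one_eq smult_T)

lemma block_perm_inv:
  assumes "w permutes {1..k + l}"
  shows "block_perm k l (inv_into UNIV w) \<longleftrightarrow> block_perm k l w"
proof -
  have "inv_into UNIV w ` {1..k} = {1..k} \<longleftrightarrow> w ` {1..k} = {1..k}"
  proof
    assume "inv_into UNIV w ` {1..k} = {1..k}"
    then show "w ` {1..k} = {1..k}"
      using image_f_inv_f[OF permutes_surj[OF assms], of "{1..k}"] by (simp only:)
  next
    assume "w ` {1..k} = {1..k}"
    then show "inv_into UNIV w ` {1..k} = {1..k}"
      using image_inv_f_f[OF permutes_inj[OF assms], of "{1..k}"] by (simp only:)
  qed
  then show ?thesis using assms permutes_inv[OF assms] by (simp add: block_perm_def)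
qed

text \<open>Moving \<open>w\<close> from the second alphabet to the inverse of \<open>w\<close> on the first reduces this to the dual
  Cauchy identity with a renamed first alphabet.\<close>
lemma conj_eval_delta_rep:
  assumes w: "w permutes {1..k + l}"
  shows "conj_eval w delta_rep = (if block_perm k l w then (- 1) ^ (k * l) * cross_diff k l else 0)"
proof -
  have inv_w: "inv_into UNIV w permutes {1..k + l}" using w by (rule permutes_inv)
  have neg1: "rename f ((- 1) ^ a) = (- 1) ^ a" for f a by (simp add: rename_power rename_uminus)
  have undo: "rename w (rename (inv_into UNIV w) p) = p" for p
    using permutes_inv_o(1)[OF w] by (simp only: rename_rename rename_id)
  have expand: "conj_eval w delta_rep = (\<Sum>\<alpha>\<in>box_partitions k l.
      (- 1) ^ sum_list \<alpha> * (schur 0 \<alpha> * rename w (schur k (dual_part l \<alpha>))))" for w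
    by (simp add: delta_rep_def conj_eval_def lin_sum mult.assoc)
  have id: "conj_eval id delta_rep = (- 1) ^ (k * l) * cross_diff k l"
    by (simp only: expand rename_id dual_cauchy)
  show ?thesis
  proof (cases "block_perm k l w")
    case True
    then show ?thesis using conj_eval_block_perm[OF delta_rep_in_F True] id by simp
  next
    case False
    have "conj_eval w delta_rep = rename w (\<Sum>\<alpha>\<in>box_partitions k l.
        (- 1) ^ sum_list \<alpha> * (rename (inv_into UNIV w) (schur 0 \<alpha>) * schur k (dual_part l \<alpha>)))"
      by (simp only: expand rename_sum rename_mult neg1 undo)
    also have "\<dots> = 0"
      using False unfolding dual_cauchy_rename[OF inv_w] block_perm_inv[OF w] by simp
    finally show ?thesis using False by simp
  qed
qed

lemma conj_eval_id_delta_rep: "conj_eval id delta_rep \<noteq> 0"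
  using conj_eval_delta_rep[OF permutes_id] cross_diff_nonzero[of k l]
  by (simp add: block_perm_def permutes_id)

lemma lmul_delta_rep_in_F: "p \<in> R_pair k l \<Longrightarrow> in_F (lmul p delta_rep)"
  using lmul_in_F delta_rep_in_F by (simp add: in_F_def)

lemma bimodule_hom_iff:
  "f \<in> bimodule_hom (R_pair k l) M T \<longleftrightarrow>
    f \<in> R_pair k l \<rightarrow> carrier T \<and>
    (\<forall>x\<in>R_pair k l. \<forall>y\<in>R_pair k l. f (x + y) = f x \<oplus>\<^bsub>T\<^esub> f y) \<and>
    (\<forall>r\<in>R_pair k l. \<forall>x\<in>R_pair k l. f (r * x) = r \<odot>\<^bsub>T\<^esub> f x) \<and>
    (\<forall>r\<in>R_pair k l. \<forall>x\<in>R_pair k l. f (x * r) = rsmult T (f x) r)"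
proof -
  have "carrier M = R_pair k l" "x \<oplus>\<^bsub>M\<^esub> y = x + y" "r \<odot>\<^bsub>M\<^esub> x = r * x" "rsmult M x r = x * r" for x y r
    by (simp_all add: regular_bimodule_def)
  then show ?thesis by (simp only: bimodule_hom_def mem_Collect_eq)
qed

lemma Delta_bimodule_hom: "Delta k l \<in> bimodule_hom (R_pair k l) M T"
  unfolding bimodule_hom_iff
proof (intro conjI ballI funcsetI)
  fix x assume x: "x \<in> R_pair k l"
  show "Delta k l x \<in> carrier T"
    using cls_in_carrier lmul_delta_rep_in_F[OF x] by (simp only: Delta_eq[OF x] in_F_def)
  fix y assume y: "y \<in> R_pair k l"
  note xy = add_closed[OF x y]
  have "cls (lmul (x + y) delta_rep) = cls (lmul x delta_rep + lmul y delta_rep)"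
  proof (rule cls_eqI)
    show "in_F (lmul x delta_rep + lmul y delta_rep)"
      using lmul_delta_rep_in_F[OF x] lmul_delta_rep_in_F[OF y] unfolding in_F_def
      by (rule keys_add_subset)
    show "conj_eval w (lmul (x + y) delta_rep) = conj_eval w (lmul x delta_rep + lmul y delta_rep)" for w
    proof -
      have "conj_eval w (lmul x delta_rep + lmul y delta_rep)
          = conj_eval w (lmul x delta_rep) + conj_eval w (lmul y delta_rep)"
        by (simp only: conj_eval_def lin_add)
      then show ?thesis by (simp only: conj_eval_lmul distrib_right)
    qed
  qed (rule lmul_delta_rep_in_F[OF xy])
  then show "Delta k l (x + y) = Delta k l x \<oplus>\<^bsub>T\<^esub> Delta k l y"
    by (simp only: Delta_eq[OF x] Delta_eq[OF y] Delta_eq[OF xy] add_T)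
next
  fix r x assume r: "r \<in> R_pair k l" and x: "x \<in> R_pair k l"
  note rx = mult_closed[OF r x] and xr = mult_closed[OF x r]
  note D = lmul_delta_rep_in_F[OF x, unfolded in_F_def]
  have "cls (lmul (r * x) delta_rep) = cls (lmul r (lmul x delta_rep))"
    by (rule cls_eqI) (use lmul_delta_rep_in_F[OF rx] lmul_in_F[OF r D] in
      \<open>simp_all only: in_F_def conj_eval_lmul mult.assoc\<close>)
  then show "Delta k l (r * x) = r \<odot>\<^bsub>T\<^esub> Delta k l x"
    by (simp only: Delta_eq[OF x] Delta_eq[OF rx] smult_T[OF r])
  have "cls (lmul (x * r) delta_rep) = cls (rmul r (lmul x delta_rep))"
  proof (rule cls_eqI)
    show "in_F (rmul r (lmul x delta_rep))" using rmul_in_F[OF r D] by (simp only: in_F_def)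
    fix w assume w: "w permutes {1..k + l}"
    have "rename w r * conj_eval w delta_rep = r * conj_eval w delta_rep"
      using r by (simp add: conj_eval_delta_rep[OF w] R_pair_iff)
    then show "conj_eval w (lmul (x * r) delta_rep) = conj_eval w (rmul r (lmul x delta_rep))"
      by (simp only: conj_eval_lmul conj_eval_rmul ac_simps)
  qed (rule lmul_delta_rep_in_F[OF xr])
  then show "Delta k l (x * r) = rsmult T (Delta k l x) r"
    by (simp only: Delta_eq[OF x] Delta_eq[OF xr] rsmult_T[OF r])
qed

lemma Delta_nonzero: "nonzero_map M T (Delta k l)"
  unfolding nonzero_map_def
proof (rule bexI[of _ 1])
  have "cls (lmul 1 delta_rep) \<noteq> cls 0"
  proof
    assume "cls (lmul 1 delta_rep) = cls 0"
    then have "lmul 1 delta_rep \<in> K" by (simp add: cls_eq_iff)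
    from conj_eval_K[OF permutes_id this] show False
      using conj_eval_id_delta_rep by (simp add: conj_eval_lmul)
  qed
  then show "Delta k l 1 \<noteq> \<zero>\<^bsub>T\<^esub>" unfolding Delta_eq[OF one_closed] zero_T .
  show "1 \<in> carrier M" using one_closed by (simp add: regular_bimodule_def)
qed

text \<open>Conjugation preserves the number of cells: counting the cells of the complement by columns gives
  the left summand, counting them by rows gives \<open>k * l - sum_list \<alpha>\<close>.\<close>
lemma sum_dual_part:
  assumes "\<alpha> \<in> box_partitions k l"
  shows "sum_list (dual_part l \<alpha>) + sum_list \<alpha> = k * l"
proof -
  have "sum_list (dual_part l \<alpha>) = (\<Sum>j\<in>{1..<Suc l}. card {i. i < k \<and> j \<le> complementary l \<alpha> ! i})"
    using assms unfolding dual_part_def conjugate_def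
    by (simp add: complementary_def box_partitions_def sum_list_distinct_conv_sum_set del: upt_Suc)
  also have "\<dots> = (\<Sum>j\<in>{1..<Suc l}. \<Sum>i<k. if j \<le> complementary l \<alpha> ! i then 1 else 0)"
    by (intro sum.cong refl) (simp add: sum.If_cases lessThan_def Int_def conj_commute)
  also have "\<dots> = (\<Sum>i<k. \<Sum>j\<in>{1..<Suc l}. if j \<le> complementary l \<alpha> ! i then 1 else 0)"
    by (rule sum.swap)
  also have "\<dots> = (\<Sum>i<k. l - \<alpha> ! (k - Suc i))"
  proof (rule sum.cong)
    fix i assume "i \<in> {..<k}"
    then have c: "complementary l \<alpha> ! i = l - \<alpha> ! (k - Suc i)"
      using assms by (simp add: complementary_def rev_nth box_partitions_def)
    define m where "m = l - \<alpha> ! (k - Suc i)"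
    have "(\<Sum>j\<in>{1..<Suc l}. if j \<le> m then 1 else 0) = (\<Sum>j\<in>{1..<Suc l} \<inter> {j. j \<le> m}. 1)"
      by (simp only: sum.inter_restrict[OF finite_atLeastLessThan] mem_Collect_eq)
    also have "{1..<Suc l} \<inter> {j. j \<le> m} = {1..m}" by (auto simp: m_def)
    also have "(\<Sum>j\<in>{1..m}. 1) = m" by simp
    finally show "(\<Sum>j\<in>{1..<Suc l}. if j \<le> complementary l \<alpha> ! i then 1 else 0) = l - \<alpha> ! (k - Suc i)"
      unfolding c m_def[symmetric] .
  qed simp
  also have "\<dots> = (\<Sum>i<k. l - \<alpha> ! i)"
    by (rule sum.nat_diff_reindex)
  finally show ?thesis using sum_complement[OF assms] by simp
qed

lemma Delta_degree: "has_degree M T (Delta k l) (2 * int k * int l)"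
  unfolding has_degree_def
proof (intro allI ballI)
  fix n x assume "x \<in> grade M n"
  then have x: "x \<in> R_pair k l" "homogeneous n x" by (auto simp: regular_bimodule_def)
  have "lmul x delta_rep = (\<Sum>\<alpha>\<in>box_partitions k l.
      frag_of (x * ((- 1) ^ sum_list \<alpha> * schur 0 \<alpha>), schur k (dual_part l \<alpha>)))"
    unfolding delta_rep_def lmul_def by (subst frag_extend_sum) simp_all
  moreover have "cls (\<Sum>\<alpha>\<in>box_partitions k l.
      frag_of (x * ((- 1) ^ sum_list \<alpha> * schur 0 \<alpha>), schur k (dual_part l \<alpha>)))
    \<in> grade T (n + 2 * int k * int l)"
  proof (rule sum_in_grade_T[OF finite_box_partitions])
    fix \<alpha> assume \<alpha>: "\<alpha> \<in> box_partitions k l"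
    have "homogeneous (n + 2 * int (sum_list \<alpha>)) (x * ((- 1) ^ sum_list \<alpha> * schur 0 \<alpha>))"
      using x(2) unfolding homogeneous_iff_homog
      by (intro homog_mult homog_neg1_power_mult homog_schur)
    moreover have "homogeneous (2 * int (sum_list (dual_part l \<alpha>))) (schur k (dual_part l \<alpha>))"
      unfolding homogeneous_iff_homog by (rule homog_schur)
    moreover have "n + 2 * int (sum_list \<alpha>) + 2 * int (sum_list (dual_part l \<alpha>)) = n + 2 * int k * int l"
      using arg_cong[OF sum_dual_part[OF \<alpha>], of int] by (simp add: algebra_simps)
    ultimately show "x * ((- 1) ^ sum_list \<alpha> * schur 0 \<alpha>) \<in> R_pair k l \<and>
        schur k (dual_part l \<alpha>) \<in> R_pair k l \<and>
        (\<exists>i j. homogeneous i (x * ((- 1) ^ sum_list \<alpha> * schur 0 \<alpha>)) \<and>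
          homogeneous j (schur k (dual_part l \<alpha>)) \<and> i + j = n + 2 * int k * int l)"
      using schur_pair_in_R[OF \<alpha> x(1)] by blast
  qed
  ultimately show "Delta k l x \<in> grade T (n + 2 * int k * int l)"
    by (simp only: Delta_eq[OF x(1)])
qed

text \<open>Evaluating \<open>r t = t r\<close> gives \<open>(r - w(r)) \<cdot> conj_eval w t = 0\<close>; take \<open>r = z\<^sub>1 + \<dots> + z\<^sub>k\<close>.\<close>
lemma central_element_conj_eval:
  assumes t: "in_F t" and central: "\<And>r. r \<in> R_pair k l \<Longrightarrow> cls (lmul r t) = cls (rmul r t)"
    and w: "w permutes {1..k + l}" "\<not> block_perm k l w"
  shows "conj_eval w t = 0"
proof -
  define r where "r = (\<Sum>i\<in>{1..k}. Var i)"
  have "lmul r t - rmul r t \<in> K"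
    using central[of r] sum_Var_in_R_pair by (simp only: r_def cls_eq_iff)
  from conj_eval_K[OF w(1) this] have "conj_eval w (lmul r t) - conj_eval w (rmul r t) = 0"
    by (simp only: conj_eval_def lin_diff)
  then have "conj_eval w t * (r - rename w r) = 0"
    by (simp only: conj_eval_lmul conj_eval_rmul right_diff_distrib mult.commute)
  then have "conj_eval w t = 0 \<or> r = rename w r" by simp
  then show ?thesis using sum_Var_moved[OF w] unfolding r_def by metis
qed

text \<open>Equating \<open>z\<^sub>i\<close> and \<open>z\<^sub>j\<close> makes the transposition of \<open>i\<close> and \<open>j\<close> invisible, so the evaluation at the
  identity then becomes the evaluation at this transposition, which is zero because the transposition mixes the blocks.\<close>
lemma central_element_divisible:
  assumes t: "in_F t" and central: "\<And>r. r \<in> R_pair k l \<Longrightarrow> cls (lmul r t) = cls (rmul r t)"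
  shows "cross_diff k l dvd conj_eval id t"
  unfolding cross_diff_def
proof (rule prod_diff_dvd)
  fix i j assume ij: "(i, j) \<in> {1..k} \<times> {k + 1..k + l}"
  then show "i < j" by auto
  define w where "w = Transposition.transpose i j"
  have w: "w permutes {1..k + l}" unfolding w_def using ij by (intro permutes_swap_id) auto
  have "j \<in> w ` {1..k}" using ij by (intro image_eqI[of _ _ i]) (auto simp: w_def)
  moreover have "j \<notin> {1..k}" using ij by auto
  ultimately have not_block: "\<not> block_perm k l w" unfolding block_perm_def by metis
  have "id(j := i) \<circ> w = id(j := i)" by (auto simp: w_def fun_eq_iff transpose_def)
  then have "rename (id(j := i)) (conj_eval id t) = rename (id(j := i)) (conj_eval w t)"
    unfolding conj_eval_def rename_lin
    by (intro lin_cong) (auto simp only: rename_mult rename_rename rename_id split: prod.splits)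
  also have "\<dots> = 0" using central_element_conj_eval[OF t central w not_block] by simp
  finally show "Var i - Var j dvd conj_eval id t"
    using \<open>i < j\<close> by (intro diff_dvd_iff[THEN iffD2]) auto
qed simp

lemma bimodule_hom_representative:
  assumes f: "f \<in> bimodule_hom (R_pair k l) M T" and deg: "has_degree M T f d"
  obtains t where "in_F t" "\<And>p. p \<in> R_pair k l \<Longrightarrow> f p = cls (lmul p t)"
    "\<And>r. r \<in> R_pair k l \<Longrightarrow> cls (lmul r t) = cls (rmul r t)" "homogeneous d (conj_eval id t)"
proof -
  have "1 \<in> grade M 0"
    using one_closed homog_1 by (simp add: regular_bimodule_def homogeneous_iff_homog)
  then have "f 1 \<in> grade T d" using deg unfolding has_degree_def by fastforce
  then obtain t where t: "Poly_Mapping.keys t \<subseteq> R_pair k l \<times> R_pair k l" "f 1 = cls t"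
      "homogeneous d (lin (\<lambda>(x, y). x * rename id y) t)"
    using grade_T_homogeneous[of "f 1" d "\<lambda>(x, y). x * rename id y"]
    by (auto simp: homogeneous_iff_homog rename_id homog_mult)
  have left: "f p = cls (lmul p t)" if p: "p \<in> R_pair k l" for p
  proof -
    have "f (p * 1) = p \<odot>\<^bsub>T\<^esub> f 1" using f p one_closed unfolding bimodule_hom_iff by blast
    then show ?thesis by (simp only: mult_1_right t(2) smult_T[OF p])
  qed
  have right: "f p = cls (rmul p t)" if p: "p \<in> R_pair k l" for p
  proof -
    have "f (1 * p) = rsmult T (f 1) p" using f p one_closed unfolding bimodule_hom_iff by blast
    then show ?thesis by (simp only: mult_1_left t(2) rsmult_T[OF p])
  qed
  show ?thesis
    by (rule that[of t]) (use t left right in \<open>simp_all only: in_F_def conj_eval_def\<close>)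
qed

text \<open>All evaluations of the image of \<open>1\<close> are determined by a single polynomial \<open>g\<close>, whose degree is that
  of the map lowered by \<open>2 k l\<close>.\<close>
lemma bimodule_hom_cofactor:
  assumes f: "f \<in> bimodule_hom (R_pair k l) M T" and deg: "has_degree M T f d"
  obtains t g where "in_F t" "\<And>p. p \<in> R_pair k l \<Longrightarrow> f p = cls (lmul p t)"
    "\<And>w. w permutes {1..k + l} \<Longrightarrow>
       conj_eval w t = (if block_perm k l w then g * cross_diff k l else 0)"
    "homog (\<lambda>_. 2) (d - 2 * int k * int l) g"
proof -
  obtain t where t: "in_F t" "\<And>p. p \<in> R_pair k l \<Longrightarrow> f p = cls (lmul p t)"
    "\<And>r. r \<in> R_pair k l \<Longrightarrow> cls (lmul r t) = cls (rmul r t)" "homogeneous d (conj_eval id t)"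
    using bimodule_hom_representative[OF f deg] by blast
  obtain g where g: "conj_eval id t = g * cross_diff k l"
    using central_element_divisible[OF t(1,3)] by (auto simp: dvd_def mult.commute)
  have "homog (\<lambda>_. 2) (d - 2 * int k * int l) g"
    by (rule homog_cofactor[OF homog_cross_diff cross_diff_nonzero])
       (use t(4) in \<open>simp only: g homogeneous_iff_homog\<close>)
  moreover have "conj_eval w t = (if block_perm k l w then g * cross_diff k l else 0)"
    if "w permutes {1..k + l}" for w
    using conj_eval_block_perm[OF t(1), of w] central_element_conj_eval[OF t(1,3) that] g by simp
  ultimately show ?thesis using that[of t g] t(1,2) by blast
qed

lemma bimodule_hom_low_degree:
  assumes "f \<in> bimodule_hom (R_pair k l) M T" "has_degree M T f d" "d < 2 * int k * int l"
  shows "\<not> nonzero_map M T f"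
proof -
  obtain t g where t: "in_F t" "\<And>p. p \<in> R_pair k l \<Longrightarrow> f p = cls (lmul p t)"
    "\<And>w. w permutes {1..k + l} \<Longrightarrow>
       conj_eval w t = (if block_perm k l w then g * cross_diff k l else 0)"
    "homog (\<lambda>_. 2) (d - 2 * int k * int l) g"
    using bimodule_hom_cofactor[OF assms(1,2)] by blast
  have "g = 0" using homog_2_negative_imp_0[OF t(4)] assms(3) by simp
  then have "conj_eval w t = 0" if "w permutes {1..k + l}" for w using t(3)[OF that] by simp
  then have "t \<in> K" using conj_eval_injective[OF t(1)] by blast
  have "f p = \<zero>\<^bsub>T\<^esub>" if p: "p \<in> R_pair k l" for p
    using lmul_K[OF p \<open>t \<in> K\<close>] by (simp only: t(2)[OF p] zero_T cls_eq_iff diff_0_right)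
  then show ?thesis by (auto simp: nonzero_map_def regular_bimodule_def)
qed

lemma bimodule_hom_critical_degree:
  assumes f: "f \<in> bimodule_hom (R_pair k l) M T" "has_degree M T f (2 * int k * int l)"
    and nonzero: "nonzero_map M T f"
  shows "\<exists>c. c \<noteq> 0 \<and> (\<forall>p\<in>R_pair k l. f p = Const c \<odot>\<^bsub>T\<^esub> Delta k l p)"
proof -
  obtain t g where t: "in_F t" "\<And>p. p \<in> R_pair k l \<Longrightarrow> f p = cls (lmul p t)"
    "\<And>w. w permutes {1..k + l} \<Longrightarrow>
       conj_eval w t = (if block_perm k l w then g * cross_diff k l else 0)"
    "homog (\<lambda>_. 2) (2 * int k * int l - 2 * int k * int l) g"
    using bimodule_hom_cofactor[OF f] by blast
  obtain b where b: "g = Const b" using homog_2_0_imp_Const[of g] t(4) by auto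
  define c where "c = b * (- 1) ^ (k * l)"
  have Const_c: "Const c \<in> R_pair k l" by (rule R_pair_closed)
  have neg1: "((- 1) ^ a :: mpoly) = Const ((- 1) ^ a)" for a
    by (induction a) (auto simp: Const_mult Const_uminus)
  have "c * (- 1) ^ (k * l) = b"
    by (simp add: c_def mult.assoc flip: power_mult_distrib)
  then have scale: "conj_eval w t = Const c * conj_eval w delta_rep" if "w permutes {1..k + l}" for w
    unfolding t(3)[OF that] conj_eval_delta_rep[OF that] neg1
    by (auto simp: b mult.assoc[symmetric] simp flip: Const_mult)
  have eq: "f p = Const c \<odot>\<^bsub>T\<^esub> Delta k l p" if p: "p \<in> R_pair k l" for p
  proof -
    have "cls (lmul p t) = cls (lmul (Const c) (lmul p delta_rep))"
    proof (rule cls_eqI)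
      show "in_F (lmul p t)" "in_F (lmul (Const c) (lmul p delta_rep))"
        using lmul_in_F p t(1) Const_c delta_rep_in_F by (simp_all only: in_F_def)
      show "conj_eval w (lmul p t) = conj_eval w (lmul (Const c) (lmul p delta_rep))"
        if "w permutes {1..k + l}" for w
        by (simp only: conj_eval_lmul scale[OF that] ac_simps)
    qed
    then show ?thesis by (simp only: t(2)[OF p] Delta_eq[OF p] smult_T[OF Const_c])
  qed
  have "c \<noteq> 0"
  proof
    assume "c = 0"
    then have "conj_eval w t = 0" if "w permutes {1..k + l}" for w using scale[OF that] by simp
    then have "t \<in> K" using conj_eval_injective[OF t(1)] by blast
    have "f p = \<zero>\<^bsub>T\<^esub>" if p: "p \<in> R_pair k l" for p
      using lmul_K[OF p \<open>t \<in> K\<close>] by (simp only: t(2)[OF p] zero_T cls_eq_iff diff_0_right)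
    then show False using nonzero by (auto simp: nonzero_map_def regular_bimodule_def)
  qed
  then show ?thesis using eq by blast
qed

end

theorem theorem1:
  fixes k l :: nat
  assumes "k \<ge> 1" and "l \<ge> 1"
  shows "Delta k l \<in> bimodule_hom (R_pair k l) (Rkl k l) (Rkl_tensor k l) \<and>
    nonzero_map (Rkl k l) (Rkl_tensor k l) (Delta k l) \<and>
    has_degree (Rkl k l) (Rkl_tensor k l) (Delta k l) (2 * int k * int l) \<and>
    (\<forall>f \<in> bimodule_hom (R_pair k l) (Rkl k l) (Rkl_tensor k l).
       has_degree (Rkl k l) (Rkl_tensor k l) f (2 * int k * int l) \<longrightarrow>
       nonzero_map (Rkl k l) (Rkl_tensor k l) f \<longrightarrow>
       (\<exists>c::complex. c \<noteq> 0 \<and> (\<forall>p \<in> R_pair k l. f p = Const c \<odot>\<^bsub>Rkl_tensor k l\<^esub> Delta k l p))) \<and>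
    (\<forall>d < 2 * int k * int l. \<forall>f \<in> bimodule_hom (R_pair k l) (Rkl k l) (Rkl_tensor k l).
       has_degree (Rkl k l) (Rkl_tensor k l) f d \<longrightarrow>
       \<not> nonzero_map (Rkl k l) (Rkl_tensor k l) f)"
proof -
  interpret bimodule_setup k l .
  show ?thesis
    using Delta_bimodule_hom Delta_nonzero Delta_degree bimodule_hom_critical_degree
      bimodule_hom_low_degree
    by blast
qed

end
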